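(* Let $1<q\le2$, $p>1$, and let $[X,\mathcal B,m^i,\nu_i]$ ($i=1,2$) be reversible random walk spaces on the same measurable space with $\nu_2\ll\nu_1$, $\mu=\frac{d\nu_2}{d\nu_1}\in L^\infty(X,\nu_1)$ and $\mu\ge c>0$ $\nu_1$-a.e. Assume either (a) $\nu_1(X)<\infty$; or (b) $\nu_1(X)=+\infty$ and $q\le\frac{p}{p-1}\le2\le p$. Then, with $H=L^2(X,\nu_1)$, $$\partial_H\big(\mathcal F_{q,m^1}+\mathcal F_{p,m^2}\big)=-\Delta_q^{m^1}-\mu\Delta_p^{m^2}.$$ Moreover, this operator is completely accretive and has dense domain in $H$.
   Context: Random walk space $[X,\mathcal B,m,\nu]$: measurable space with countably generated $\sigma$-algebra, probability measures $m_x$ depending measurably on $x$, $\sigma$-finite invariant measure $\nu$ ($\nu(A)=\int m_x(A)\,d\nu(x)$), reversible if $dm_x(y)d\nu(x)=dm_y(x)d\nu(y)$. $\nabla u(x,y)=u(y)-u(x)$. On $H$: $\mathcal F_{q,m^1}(u)=\frac1{2q}\int_{X\times X}|\nabla u|^q\,dm^1_x(y)d\nu_1(x)$ and $\mathcal F_{p,m^2}(u)=\frac1{2p}\int_{X\times X}|\nabla u|^p\,dm^2_x(y)d\nu_2(x)$, each $+\infty$ if infinite. $\partial_H$ is the convex subdifferential. For $s>1$, in a random walk space $[X,\mathcal B,m,\nu]$: $(u,w)\in\Delta_s^m$ iff $u,w\in L^2(X,\nu)$, $\nabla u\in L^s(dm_x(y)d\nu(x))$ and $w(x)=\int_X|\nabla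 u(x,y)|^{s-2}\nabla u(x,y)\,dm_x(y)$. The operator $-\Delta_q^{m^1}-\mu\Delta_p^{m^2}$ on $H$ consists of $(u,v)$, $u,v\in H$, $v=-w_1-\mu w_2$ with $(u,w_1)\in\Delta_q^{m^1}$ (w.r.t. $\nu_1$), $(u,w_2)\in\Delta_p^{m^2}$ (w.r.t. $\nu_2$). Complete accretivity of $A\subset H\times H$: for all $\lambda>0$, $(u_1,v_1),(u_2,v_2)\in A$, $\int j(u_1-u_2)\,d\nu_1\le\int j(u_1-u_2+\lambda(v_1-v_2))\,d\nu_1$ for all convex lower semicontinuous $j:\mathbb R\to[0,\infty]$ with $j(0)=0$. *)

theory Defs
  imports "HOL-Probability.Probability"
begin

definition random_walk_space :: "('a \<Rightarrow> 'a measure) \<Rightarrow> 'a measure \<Rightarrow> bool" where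
  "random_walk_space m \<nu> \<longleftrightarrow>
     (\<exists>G. countable G \<and> sets \<nu> = sigma_sets (space \<nu>) G) \<and>
     m \<in> \<nu> \<rightarrow>\<^sub>M prob_algebra \<nu> \<and>
     sigma_finite_measure \<nu> \<and>
     (\<forall>A\<in>sets \<nu>. emeasure \<nu> A = (\<integral>\<^sup>+ x. emeasure (m x) A \<partial>\<nu>))"

text \<open>Reversibility dm_x(y)dnu(x) = dm_y(x)dnu(y), tested on measurable rectangles A x B.\<close>
definition reversible :: "('a \<Rightarrow> 'a measure) \<Rightarrow> 'a measure \<Rightarrow> bool" where
  "reversible m \<nu> \<longleftrightarrow>
     (\<forall>A\<in>sets \<nu>. \<forall>B\<in>sets \<nu>.
        (\<integral>\<^sup>+ x. indicator A x * emeasure (m x) B \<partial>\<nu>) =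
        (\<integral>\<^sup>+ x. indicator B x * emeasure (m x) A \<partial>\<nu>))"

definition L2 :: "'a measure \<Rightarrow> ('a \<Rightarrow> real) set" where
  "L2 \<nu> = {u. u \<in> borel_measurable \<nu> \<and> integrable \<nu> (\<lambda>x. (u x)\<^sup>2)}"

definition grad_energy :: "('a \<Rightarrow> 'a measure) \<Rightarrow> 'a measure \<Rightarrow> real \<Rightarrow> ('a \<Rightarrow> real) \<Rightarrow> ennreal" where
  "grad_energy m \<nu> s u = (\<integral>\<^sup>+ x. (\<integral>\<^sup>+ y. ennreal (\<bar>u y - u x\<bar> powr s) \<partial>(m x)) \<partial>\<nu>)"

definition energy :: "('a \<Rightarrow> 'a measure) \<Rightarrow> 'a measure \<Rightarrow> real \<Rightarrow> ('a \<Rightarrow> real) \<Rightarrow> ereal" where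
  "energy m \<nu> s u = ereal (1 / (2 * s)) * enn2ereal (grad_energy m \<nu> s u)"

definition subdiff :: "'a measure \<Rightarrow> (('a \<Rightarrow> real) \<Rightarrow> ereal) \<Rightarrow> (('a \<Rightarrow> real) \<times> ('a \<Rightarrow> real)) set" where
  "subdiff \<nu> F = {(u, v). u \<in> L2 \<nu> \<and> v \<in> L2 \<nu> \<and> F u < \<infinity> \<and>
      (\<forall>w\<in>L2 \<nu>. F w \<ge> F u + ereal (\<integral>x. v x * (w x - u x) \<partial>\<nu>))}"

definition p_laplacian :: "('a \<Rightarrow> 'a measure) \<Rightarrow> 'a measure \<Rightarrow> real \<Rightarrow> (('a \<Rightarrow> real) \<times> ('a \<Rightarrow> real)) set" where
  "p_laplacian m \<nu> s = {(u, w). u \<in> L2 \<nu> \<and> w \<in> L2 \<nu> \<and> grad_energy m \<nu> s u < \<infinity> \<and>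
      (AE x in \<nu>. w x = (\<integral>y. \<bar>u y - u x\<bar> powr (s - 2) * (u y - u x) \<partial>(m x)))}"

definition sum_operator ::
  "('a \<Rightarrow> 'a measure) \<Rightarrow> 'a measure \<Rightarrow> real \<Rightarrow> ('a \<Rightarrow> 'a measure) \<Rightarrow> 'a measure \<Rightarrow> real \<Rightarrow>
   ('a \<Rightarrow> real) \<Rightarrow> (('a \<Rightarrow> real) \<times> ('a \<Rightarrow> real)) set" where
  "sum_operator m1 \<nu>1 q m2 \<nu>2 p \<mu> = {(u, v). u \<in> L2 \<nu>1 \<and> v \<in> L2 \<nu>1 \<and>
      (\<exists>w1 w2. (u, w1) \<in> p_laplacian m1 \<nu>1 q \<and> (u, w2) \<in> p_laplacian m2 \<nu>2 p \<and>
         (AE x in \<nu>1. v x = - w1 x - \<mu> x * w2 x))}"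

definition convex_ennreal_fun :: "(real \<Rightarrow> ennreal) \<Rightarrow> bool" where
  "convex_ennreal_fun j \<longleftrightarrow> (\<forall>x y t. 0 \<le> t \<longrightarrow> t \<le> 1 \<longrightarrow>
      j ((1 - t) * x + t * y) \<le> ennreal (1 - t) * j x + ennreal t * j y)"

definition lsc_ennreal_fun :: "(real \<Rightarrow> ennreal) \<Rightarrow> bool" where
  "lsc_ennreal_fun j \<longleftrightarrow> (\<forall>x X. X \<longlonglongrightarrow> x \<longrightarrow> j x \<le> liminf (\<lambda>n. j (X n)))"

definition completely_accretive :: "'a measure \<Rightarrow> (('a \<Rightarrow> real) \<times> ('a \<Rightarrow> real)) set \<Rightarrow> bool" where
  "completely_accretive \<nu> A \<longleftrightarrow>
     (\<forall>t>0::real. \<forall>(u1, v1)\<in>A. \<forall>(u2, v2)\<in>A. \<forall>j. convex_ennreal_fun j \<and> lsc_ennreal_fun j \<and> j 0 = 0 \<longrightarrow>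
        (\<integral>\<^sup>+ x. j (u1 x - u2 x) \<partial>\<nu>) \<le> (\<integral>\<^sup>+ x. j (u1 x - u2 x + t * (v1 x - v2 x)) \<partial>\<nu>))"

definition dense_domain :: "'a measure \<Rightarrow> (('a \<Rightarrow> real) \<times> ('a \<Rightarrow> real)) set \<Rightarrow> bool" where
  "dense_domain \<nu> A \<longleftrightarrow>
     (\<forall>f\<in>L2 \<nu>. \<forall>\<epsilon>>0. \<exists>(u, v)\<in>A. (\<integral>x. (f x - u x)\<^sup>2 \<partial>\<nu>) < \<epsilon>)"

end

theory Submission
  imports Defs
begin

text \<open>
  Reversibility makes the measure dm_x(y) d\<nu>(x) symmetric, which gives the integration by parts
  formula for antisymmetric integrands; it extends to test functions that are only in L2 and of
  finite energy by truncating them with 1-Lipschitz maps. Together with the tangent inequality for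
  |a|^s it shows that the operator is contained in the subdifferential.

  Conversely, differentiating the energy of a subdifferential element (u, v) along bounded test
  functions of finite support identifies v with -w1 - \<mu> w2. By Jensen, w1 and w2 lie in the L^r
  spaces with r = q/(q-1) >= 2 and r = p/(p-1). If \<nu>1 is finite this puts w1 in L2; otherwise
  p/(p-1) <= 2, so w1 can only fail to be square integrable where it is small, and there it is
  controlled by v and w2. In both cases w2 is in L2 as well, because \<mu> is bounded below.

  For complete accretivity, a convex lower semicontinuous j is approximated from below by Lipschitz
  convex functions vanishing near 0. Their subgradients T are bounded, monotone and vanish near 0,
  so T(u1 - u2) may be used as a test function without any continuity of T, and monotonicity of
  |a|^(s-2) a gives the sign. The domain is dense because it contains all truncations of L2
  functions.
\<close>

section \<open>Power functions and truncations\<close>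

text \<open>On a space of infinite measure L2 and L^s need not contain one another, so neither
  \<open>laplace s u\<close> nor a square integrable test function can be paired with the other a
  priori. Every pairing is therefore first made with test functions that lie in all the L^s needed
  at once: truncations, sign functions on sets of finite measure, and compositions with monotone
  maps that vanish near 0. Convexity of the energies enters only through the tangent inequality for
  |a|^s. It also yields monotonicity, Jensen's inequality and an upper bound for directional
  increments, so no differentiation under the integral sign takes place. Both inclusions are shown
  directly: no range condition for a resolvent and no maximality of the operator is invoked. The
  weight \<mu> appears because the second Laplacian is symmetric with respect to \<nu>2, while
  subgradients are represented in L2 of \<nu>1.\<close>

definition signed_power :: "real \<Rightarrow> real \<Rightarrow> real" where
  "signed_power s a = \<bar>a\<bar> powr (s - 2) * a"

lemma signed_power_minus [simp]: "signed_power s (- a) = - signed_power s a"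
  by (simp add: signed_power_def)

lemma abs_signed_power: "\<bar>signed_power s a\<bar> = \<bar>a\<bar> powr (s - 1)"
proof (cases "a = 0")
  case False
  then show ?thesis
    using powr_mult_base[of "\<bar>a\<bar>" "s - 2"] by (simp add: signed_power_def abs_mult mult.commute)
qed (simp add: signed_power_def)

lemma signed_power_mult_self: "signed_power s a * a = \<bar>a\<bar> powr s"
proof (cases "a = 0")
  case False
  have "signed_power s a * a = \<bar>a\<bar> powr (s - 2) * \<bar>a\<bar>\<^sup>2"
    by (simp add: signed_power_def power2_eq_square)
  also have "\<bar>a\<bar>\<^sup>2 = \<bar>a\<bar> powr 2" using False by (simp add: powr_numeral)
  also have "\<bar>a\<bar> powr (s - 2) * \<bar>a\<bar> powr 2 = \<bar>a\<bar> powr s" by (subst powr_add[symmetric]) simp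
  finally show ?thesis .
qed simp

lemma signed_power_measurable [measurable]: "signed_power s \<in> borel_measurable borel"
  unfolding signed_power_def by measurable

lemma isCont_signed_power:
  assumes "1 < s" shows "isCont (signed_power s) a"
proof (cases "a = 0")
  case True
  have "((\<lambda>x. \<bar>signed_power s x\<bar>) \<longlongrightarrow> 0) (at 0)"
    unfolding abs_signed_power using assms
    by (auto intro!: tendsto_eq_intros tendsto_powr')
  then have "(signed_power s \<longlongrightarrow> 0) (at 0)" by (simp only: tendsto_rabs_zero_iff)
  then show ?thesis using True by (simp add: isCont_def) (simp add: signed_power_def)
next
  case False
  then show ?thesis unfolding signed_power_def[abs_def] by (intro continuous_intros) auto
qed

text \<open>Replacing both moduli by the larger one bounds the product by its s-th power. Sharp
  constants are irrelevant: the estimate serves only integrability and domination.\<close>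

lemma abs_signed_power_mult_le: "1 < s \<Longrightarrow> \<bar>signed_power s a * b\<bar> \<le> \<bar>a\<bar> powr s + \<bar>b\<bar> powr s"
proof -
  assume s: "1 < s"
  let ?c = "max \<bar>a\<bar> \<bar>b\<bar>"
  have c: "?c powr (s - 1) * ?c = ?c powr s"
    using powr_mult_base[of ?c "s - 1"] by (simp add: mult.commute)
  have "\<bar>signed_power s a * b\<bar> = \<bar>a\<bar> powr (s - 1) * \<bar>b\<bar>" by (simp add: abs_mult abs_signed_power)
  also have "\<dots> \<le> ?c powr (s - 1) * ?c" using s by (intro mult_mono powr_mono2) auto
  also have "\<dots> \<le> \<bar>a\<bar> powr s + \<bar>b\<bar> powr s" unfolding c by (simp add: max_def)
  finally show ?thesis .
qed

text \<open>Young's inequality for |a|^(s-1) and |b| with exponents s/(s-1) and s is the supporting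
  line of |.|^s at a in disguise. No derivative is taken, so 1 < s < 2 needs no separate treatment
  at 0.\<close>

lemma powr_abs_tangent_le:
  assumes s: "1 < s"
  shows "\<bar>a\<bar> powr s + s * (signed_power s a * (b - a)) \<le> \<bar>b\<bar> powr s"
proof -
  let ?r = "s / (s - 1)"
  have "\<bar>a\<bar> powr (s - 1) * \<bar>b\<bar> \<le> (\<bar>a\<bar> powr (s - 1)) powr ?r / ?r + \<bar>b\<bar> powr s / s"
    using s by (intro Youngs_inequality) (auto simp: field_simps)
  also have "(\<bar>a\<bar> powr (s - 1)) powr ?r = \<bar>a\<bar> powr s" using s by (simp add: powr_powr)
  finally have "s * (\<bar>a\<bar> powr (s - 1) * \<bar>b\<bar>) \<le> s * (\<bar>a\<bar> powr s / ?r + \<bar>b\<bar> powr s / s)"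
    using s by simp
  also have "\<dots> = (s - 1) * \<bar>a\<bar> powr s + \<bar>b\<bar> powr s" using s by (simp add: field_simps)
  finally have "s * (\<bar>a\<bar> powr (s - 1) * \<bar>b\<bar>) \<le> (s - 1) * \<bar>a\<bar> powr s + \<bar>b\<bar> powr s" .
  moreover have "signed_power s a * b \<le> \<bar>a\<bar> powr (s - 1) * \<bar>b\<bar>"
    by (metis abs_ge_self abs_mult abs_signed_power)
  then have "s * (signed_power s a * b) \<le> s * (\<bar>a\<bar> powr (s - 1) * \<bar>b\<bar>)"
    using s by simp
  ultimately show ?thesis
    using signed_power_mult_self[of s a] by (simp add: algebra_simps)
qed

text \<open>Adding the tangent inequalities at a and at b cancels the powers.\<close>

lemma signed_power_monotone:
  assumes s: "1 < s"
  shows "0 \<le> (signed_power s a - signed_power s b) * (a - b)"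
proof -
  have "s * (signed_power s a * (b - a)) + s * (signed_power s b * (a - b)) \<le> 0"
    using powr_abs_tangent_le[OF s, of a b] powr_abs_tangent_le[OF s, of b a] by linarith
  then have "0 \<le> s * ((signed_power s a - signed_power s b) * (a - b))"
    by (simp add: algebra_simps)
  then show ?thesis using s by (simp add: zero_le_mult_iff)
qed

lemma powr_abs_add_le:
  fixes a b r :: real
  assumes "0 < r" shows "\<bar>a + b\<bar> powr r \<le> 2 powr r * (\<bar>a\<bar> powr r + \<bar>b\<bar> powr r)"
proof -
  have "\<bar>a + b\<bar> powr r \<le> (2 * max \<bar>a\<bar> \<bar>b\<bar>) powr r"
    using assms by (intro powr_mono2) auto
  also have "\<dots> = 2 powr r * max \<bar>a\<bar> \<bar>b\<bar> powr r" by (simp add: powr_mult)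
  also have "\<dots> \<le> 2 powr r * (\<bar>a\<bar> powr r + \<bar>b\<bar> powr r)"
    by (intro mult_left_mono) (auto simp: max_def)
  finally show ?thesis .
qed

text \<open>Jensen's inequality: the tangent at the mean integrates to its value at the mean. If
  |f|^r is not integrable, the right-hand side is infinite.\<close>

lemma (in prob_space) powr_abs_expectation_le:
  assumes r: "1 < r" and f: "integrable M f"
  shows "ennreal (\<bar>expectation f\<bar> powr r) \<le> (\<integral>\<^sup>+x. ennreal (\<bar>f x\<bar> powr r) \<partial>M)"
proof (cases "integrable M (\<lambda>x. \<bar>f x\<bar> powr r)")
  case True
  let ?a = "expectation f"
  have "(\<integral>x. \<bar>?a\<bar> powr r + r * (signed_power r ?a * (f x - ?a)) \<partial>M) \<le> (\<integral>x. \<bar>f x\<bar> powr r \<partial>M)"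
    using f True r by (intro integral_mono powr_abs_tangent_le) auto
  also have "(\<integral>x. \<bar>?a\<bar> powr r + r * (signed_power r ?a * (f x - ?a)) \<partial>M) = \<bar>?a\<bar> powr r"
    using f by (simp add: prob_space)
  finally show ?thesis using True
    by (subst nn_integral_eq_integral) (auto simp: ennreal_leI)
next
  case False
  then have "(\<integral>\<^sup>+x. ennreal (\<bar>f x\<bar> powr r) \<partial>M) = \<infinity>"
    using f by (auto simp: integrable_iff_bounded less_top[symmetric])
  then show ?thesis by simp
qed

text \<open>Soft thresholding at level 1/n followed by a cut-off at height n: a 1-Lipschitz map whose
  values are bounded and vanish near 0, so it sends L2 functions into every L^s without
  increasing their gradients.\<close>

definition trunc :: "nat \<Rightarrow> real \<Rightarrow> real" where
  "trunc n x = sgn x * min (real n) (max 0 (\<bar>x\<bar> - 1 / real n))"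

lemma trunc_measurable [measurable]: "trunc n \<in> borel_measurable borel"
  unfolding trunc_def by measurable

lemma abs_trunc_le: "\<bar>trunc n x\<bar> \<le> \<bar>x\<bar>" "\<bar>trunc n x\<bar> \<le> real n"
proof -
  define d where "d = 1 / real n"
  have "0 \<le> d" "0 \<le> real n" by (auto simp: d_def)
  then show "\<bar>trunc n x\<bar> \<le> \<bar>x\<bar>" "\<bar>trunc n x\<bar> \<le> real n"
    unfolding trunc_def d_def[symmetric] by (auto simp: abs_mult sgn_if min_def max_def)
qed

lemma abs_trunc_diff_le: "\<bar>trunc n x - trunc n y\<bar> \<le> \<bar>x - y\<bar>"
proof -
  define d where "d = 1 / real n"
  have "0 \<le> d" "0 \<le> real n" by (auto simp: d_def)
  then show ?thesis unfolding trunc_def d_def[symmetric]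
    by (auto simp: sgn_if min_def max_def abs_if split: if_splits)
qed

text \<open>A Chebyshev argument: where the truncation is nonzero, |x| is at least 1/n, so the
  factor (n x)^2 \<ge> 1 may be inserted. This is what turns square integrability into integrability
  of every power, even for infinite measure.\<close>

lemma trunc_powr_le:
  assumes "0 < r"
  shows "\<bar>trunc n x\<bar> powr r \<le> real n powr r * (real n)\<^sup>2 * x\<^sup>2"
proof (cases "trunc n x = 0")
  case False
  then have n: "0 < n" by (auto simp: trunc_def)
  have "1 / real n \<le> \<bar>x\<bar>" using False by (auto simp: trunc_def max_def split: if_splits)
  then have "1 \<le> real n * \<bar>x\<bar>" using n by (simp add: field_simps)
  then have "1 \<le> (real n * \<bar>x\<bar>)\<^sup>2" by simp
  moreover have "\<bar>trunc n x\<bar> powr r \<le> real n powr r"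
    using abs_trunc_le assms by (intro powr_mono2) auto
  ultimately have "\<bar>trunc n x\<bar> powr r * 1 \<le> real n powr r * (real n * \<bar>x\<bar>)\<^sup>2"
    by (intro mult_mono) auto
  then show ?thesis by (simp add: power_mult_distrib)
qed (use assms in simp)

lemma trunc_tendsto: "(\<lambda>n. trunc n x) \<longlonglongrightarrow> x"
proof -
  obtain N where N: "\<bar>x\<bar> \<le> real N" using real_arch_simple by blast
  have "(\<lambda>n. sgn x * max 0 (\<bar>x\<bar> - 1 / real n)) \<longlonglongrightarrow> sgn x * max 0 (\<bar>x\<bar> - 0)"
    by (intro tendsto_intros lim_1_over_n)
  then have "(\<lambda>n. sgn x * max 0 (\<bar>x\<bar> - 1 / real n)) \<longlonglongrightarrow> x"
    by (simp add: sgn_mult_abs)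
  \<comment> \<open>Once n exceeds |x|, the cut-off at height n is inactive and only the soft
    thresholding remains.\<close>
  moreover have "eventually (\<lambda>n. sgn x * max 0 (\<bar>x\<bar> - 1 / real n) = trunc n x) sequentially"
    using eventually_ge_at_top[of N]
  proof eventually_elim
    case (elim n)
    then have "\<bar>x\<bar> \<le> real n" using N by linarith
    then have "max 0 (\<bar>x\<bar> - 1 / real n) \<le> real n" by (auto simp: max_def) (smt (verit) divide_nonneg_nonneg of_nat_0_le_iff)
    then show ?case by (simp add: trunc_def)
  qed
  ultimately show ?thesis by (rule Lim_transform_eventually)
qed

section \<open>The measure of a reversible walk on pairs of points\<close>

locale reversible_walk =
  fixes m :: "'a \<Rightarrow> 'a measure" and \<nu> :: "'a measure"
  assumes walk: "random_walk_space m \<nu>" and rev: "reversible m \<nu>"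
begin

lemma kernel_prob [measurable]: "m \<in> \<nu> \<rightarrow>\<^sub>M prob_algebra \<nu>"
  using walk by (simp add: random_walk_space_def)

lemma kernel_subprob [measurable]: "m \<in> \<nu> \<rightarrow>\<^sub>M subprob_algebra \<nu>"
  by (rule measurable_prob_algebraD) (rule kernel_prob)

sublocale sigma_finite_measure \<nu>
  using walk by (simp add: random_walk_space_def)

lemma prob_space_kernel: "x \<in> space \<nu> \<Longrightarrow> prob_space (m x)"
  and sets_kernel_eq: "x \<in> space \<nu> \<Longrightarrow> sets (m x) = sets \<nu>"
  using measurable_space[OF kernel_prob, of x] by (auto simp: space_prob_algebra)

lemma section_measurable:
  assumes "f \<in> borel_measurable (\<nu> \<Otimes>\<^sub>M \<nu>)" "x \<in> space \<nu>"
  shows "(\<lambda>y. f (x, y)) \<in> borel_measurable (m x)"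
  using assms by (auto simp: measurable_cong_sets[OF sets_kernel_eq refl] intro: measurable_compose[OF _ assms(1)])

lemma nn_integral_kernel_measurable:
  "f \<in> borel_measurable (\<nu> \<Otimes>\<^sub>M \<nu>) \<Longrightarrow> (\<lambda>x. \<integral>\<^sup>+y. f (x, y) \<partial>m x) \<in> borel_measurable \<nu>"
  by (rule nn_integral_measurable_subprob_algebra2[where N=\<nu>]) auto

lemma integral_kernel_measurable:
  fixes f :: "_ \<Rightarrow> real"
  assumes f[measurable]: "f \<in> borel_measurable (\<nu> \<Otimes>\<^sub>M \<nu>)"
  shows "(\<lambda>x. \<integral>y. f (x, y) \<partial>m x) \<in> borel_measurable \<nu>"
proof -
  \<comment> \<open>The case distinction reproduces the default value 0 of the integral at those x
    whose section is not integrable; each ingredient is a nonnegative kernel integral, hence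
    measurable in x.\<close>
  let ?h = "\<lambda>x. if (\<integral>\<^sup>+y. ennreal \<bar>f (x, y)\<bar> \<partial>m x) < \<infinity>
    then enn2real (\<integral>\<^sup>+y. ennreal (f (x, y)) \<partial>m x) - enn2real (\<integral>\<^sup>+y. ennreal (- f (x, y)) \<partial>m x) else 0"
  have [measurable]: "(\<lambda>x. \<integral>\<^sup>+y. ennreal \<bar>f (x, y)\<bar> \<partial>m x) \<in> borel_measurable \<nu>"
    "(\<lambda>x. \<integral>\<^sup>+y. ennreal (f (x, y)) \<partial>m x) \<in> borel_measurable \<nu>"
    "(\<lambda>x. \<integral>\<^sup>+y. ennreal (- f (x, y)) \<partial>m x) \<in> borel_measurable \<nu>"
    by (rule nn_integral_kernel_measurable[where f="\<lambda>z. ennreal \<bar>f z\<bar>"], measurable)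
      (rule nn_integral_kernel_measurable[where f="\<lambda>z. ennreal (f z)"], measurable,
       rule nn_integral_kernel_measurable[where f="\<lambda>z. ennreal (- f z)"], measurable)
  have "?h \<in> borel_measurable \<nu>" by measurable
  moreover have "(\<integral>y. f (x, y) \<partial>m x) = ?h x" if x: "x \<in> space \<nu>" for x
  proof -
    have "(\<integral>\<^sup>+y. ennreal \<bar>f (x, y)\<bar> \<partial>m x) < \<infinity> \<longleftrightarrow> integrable (m x) (\<lambda>y. f (x, y))"
      using section_measurable[OF f x] by (simp add: integrable_iff_bounded)
    then show ?thesis by (simp add: real_lebesgue_integral_def not_integrable_integral_eq)
  qed
  ultimately show ?thesis by (simp cong: measurable_cong)
qed

text \<open>The measure dm_x(y) d\<nu>(x), given by its values because the inner measure varies with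
  x. On it the gradient is a single function of a pair, and reversibility becomes invariance under
  exchange of coordinates.\<close>

definition pairs :: "('a \<times> 'a) measure" where
  "pairs = measure_of (space \<nu> \<times> space \<nu>) (sets (\<nu> \<Otimes>\<^sub>M \<nu>))
     (\<lambda>A. \<integral>\<^sup>+x. (\<integral>\<^sup>+y. indicator A (x, y) \<partial>m x) \<partial>\<nu>)"

lemma sets_pairs [simp, measurable_cong]: "sets pairs = sets (\<nu> \<Otimes>\<^sub>M \<nu>)"
  unfolding pairs_def by (simp add: space_pair_measure[symmetric])

lemma space_pairs: "space pairs = space \<nu> \<times> space \<nu>"
  using sets_eq_imp_space_eq[OF sets_pairs] by (simp add: space_pair_measure)

lemma emeasure_pairs:
  assumes "A \<in> sets (\<nu> \<Otimes>\<^sub>M \<nu>)"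
  shows "emeasure pairs A = (\<integral>\<^sup>+x. (\<integral>\<^sup>+y. indicator A (x, y) \<partial>m x) \<partial>\<nu>)"
  unfolding pairs_def
proof (rule emeasure_measure_of_sigma)
  show "sigma_algebra (space \<nu> \<times> space \<nu>) (sets (\<nu> \<Otimes>\<^sub>M \<nu>))"
    using sets.sigma_algebra_axioms[of "\<nu> \<Otimes>\<^sub>M \<nu>"] by (simp add: space_pair_measure)
  show "countably_additive (sets (\<nu> \<Otimes>\<^sub>M \<nu>)) (\<lambda>A. \<integral>\<^sup>+x. (\<integral>\<^sup>+y. indicator A (x, y) \<partial>m x) \<partial>\<nu>)"
    unfolding countably_additive_def
  proof (intro allI impI)
    fix A :: "nat \<Rightarrow> _" assume A: "range A \<subseteq> sets (\<nu> \<Otimes>\<^sub>M \<nu>)" "disjoint_family A"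
    then have [measurable]: "A i \<in> sets (\<nu> \<Otimes>\<^sub>M \<nu>)" for i by auto
    have ind: "(indicator (A i) :: _ \<Rightarrow> ennreal) \<in> borel_measurable (\<nu> \<Otimes>\<^sub>M \<nu>)" for i by measurable
    have "(\<Sum>i. \<integral>\<^sup>+x. (\<integral>\<^sup>+y. indicator (A i) (x, y) \<partial>m x) \<partial>\<nu>) =
        (\<integral>\<^sup>+x. (\<Sum>i. \<integral>\<^sup>+y. indicator (A i) (x, y) \<partial>m x) \<partial>\<nu>)"
      using nn_integral_kernel_measurable[OF ind] by (intro nn_integral_suminf[symmetric]) auto
    also have "\<dots> = (\<integral>\<^sup>+x. (\<integral>\<^sup>+y. (\<Sum>i. indicator (A i) (x, y)) \<partial>m x) \<partial>\<nu>)"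
      using section_measurable[OF ind] by (intro nn_integral_cong nn_integral_suminf[symmetric]) auto
    also have "\<dots> = (\<integral>\<^sup>+x. (\<integral>\<^sup>+y. indicator (\<Union>i. A i) (x, y) \<partial>m x) \<partial>\<nu>)"
      by (simp add: suminf_indicator[OF A(2)])
    finally show "(\<Sum>i. \<integral>\<^sup>+x. (\<integral>\<^sup>+y. indicator (A i) (x, y) \<partial>m x) \<partial>\<nu>) =
      (\<integral>\<^sup>+x. (\<integral>\<^sup>+y. indicator (\<Union>i. A i) (x, y) \<partial>m x) \<partial>\<nu>)" .
  qed
qed (use assms in \<open>auto simp: positive_def\<close>)

section \<open>Iterated integration and symmetry of the pair measure\<close>

lemma nn_integral_pairs:
  assumes "f \<in> borel_measurable (\<nu> \<Otimes>\<^sub>M \<nu>)"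
  shows "(\<integral>\<^sup>+z. f z \<partial>pairs) = (\<integral>\<^sup>+x. (\<integral>\<^sup>+y. f (x, y) \<partial>m x) \<partial>\<nu>)"
  using assms
proof induct
  case (cong f g)
  have "(\<integral>\<^sup>+z. f z \<partial>pairs) = (\<integral>\<^sup>+z. g z \<partial>pairs)"
    using cong(3) by (intro nn_integral_cong) (simp add: space_pairs space_pair_measure)
  moreover have "(\<integral>\<^sup>+x. (\<integral>\<^sup>+y. f (x, y) \<partial>m x) \<partial>\<nu>) = (\<integral>\<^sup>+x. (\<integral>\<^sup>+y. g (x, y) \<partial>m x) \<partial>\<nu>)"
    using cong(3) sets_eq_imp_space_eq[OF sets_kernel_eq]
    by (intro nn_integral_cong) (simp add: space_pair_measure)
  ultimately show ?case using cong(4) by simp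
next
  case (set A)
  then show ?case by (simp add: emeasure_pairs)
next
  case (mult f c)
  then show ?case
    using section_measurable[OF mult(2)] nn_integral_kernel_measurable[OF mult(2)]
    by (simp add: nn_integral_cmult cong: nn_integral_cong)
next
  case (add f g)
  then show ?case
    using section_measurable[OF add(1)] nn_integral_kernel_measurable[OF add(1)]
      section_measurable[OF add(4)] nn_integral_kernel_measurable[OF add(4)]
    by (simp add: nn_integral_add cong: nn_integral_cong)
next
  case (seq F)
  have inc: "incseq (\<lambda>i y. F i (x, y))" for x using seq(4) by (auto simp: incseq_def le_fun_def)
  have "(\<integral>\<^sup>+z. (SUP i. F i) z \<partial>pairs) = (SUP i. \<integral>\<^sup>+z. F i z \<partial>pairs)"
    unfolding SUP_apply using seq by (intro nn_integral_monotone_convergence_SUP) auto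
  also have "\<dots> = (SUP i. \<integral>\<^sup>+x. (\<integral>\<^sup>+y. F i (x, y) \<partial>m x) \<partial>\<nu>)"
    using seq by simp
  also have "\<dots> = (\<integral>\<^sup>+x. (SUP i. \<integral>\<^sup>+y. F i (x, y) \<partial>m x) \<partial>\<nu>)"
    using seq(1) nn_integral_kernel_measurable[OF seq(1)] inc
    by (intro nn_integral_monotone_convergence_SUP[symmetric])
       (auto simp: incseq_def le_fun_def intro!: nn_integral_mono)
  also have "\<dots> = (\<integral>\<^sup>+x. (\<integral>\<^sup>+y. (SUP i. F i (x, y)) \<partial>m x) \<partial>\<nu>)"
    using section_measurable[OF seq(1)] inc
    by (intro nn_integral_cong nn_integral_monotone_convergence_SUP[symmetric]) auto
  finally show ?case by (simp add: image_comp)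
qed

lemma nn_integral_pairs_fst:
  assumes [measurable]: "g \<in> borel_measurable \<nu>"
  shows "(\<integral>\<^sup>+z. g (fst z) \<partial>pairs) = (\<integral>\<^sup>+x. g x \<partial>\<nu>)"
  using prob_space.emeasure_space_1[OF prob_space_kernel]
  by (subst nn_integral_pairs) (auto intro!: nn_integral_cong)

lemma emeasure_pairs_Times:
  assumes "A \<in> sets \<nu>" "B \<in> sets \<nu>"
  shows "emeasure pairs (A \<times> B) = (\<integral>\<^sup>+ x. indicator A x * emeasure (m x) B \<partial>\<nu>)"
  using assms sets_kernel_eq
  by (auto simp: emeasure_pairs indicator_times nn_integral_cmult intro!: nn_integral_cong)

text \<open>Reversibility is exactly the claim on rectangles, which form a generator stable under
  intersection. Uniqueness of the extension also needs an exhaustion by sets of finite measure: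
  \<open>A i \<times> space \<nu>\<close> qualifies, since the kernels have mass one.\<close>

lemma distr_swap_pairs: "distr pairs (\<nu> \<Otimes>\<^sub>M \<nu>) (\<lambda>(x, y). (y, x)) = pairs"
proof -
  obtain A :: "nat \<Rightarrow> 'a set" where A: "range A \<subseteq> sets \<nu>" "(\<Union>i. A i) = space \<nu>" "\<And>i. emeasure \<nu> (A i) \<noteq> \<infinity>"
    using sigma_finite by metis
  let ?E = "{a \<times> b |a b. a \<in> sets \<nu> \<and> b \<in> sets \<nu>}"
  have "pairs = distr pairs (\<nu> \<Otimes>\<^sub>M \<nu>) (\<lambda>(x, y). (y, x))"
  proof (rule measure_eqI_generator_eq[OF Int_stable_pair_measure_generator[of \<nu> \<nu>]])
    show "?E \<subseteq> Pow (space \<nu> \<times> space \<nu>)"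
      using sets.space_closed[of \<nu>] by auto
    show "sets pairs = sigma_sets (space \<nu> \<times> space \<nu>) ?E"
      "sets (distr pairs (\<nu> \<Otimes>\<^sub>M \<nu>) (\<lambda>(x, y). (y, x))) = sigma_sets (space \<nu> \<times> space \<nu>) ?E"
      by (simp_all add: sets_pair_measure)
    show "range (\<lambda>i. A i \<times> space \<nu>) \<subseteq> ?E" "(\<Union>i. A i \<times> space \<nu>) = space \<nu> \<times> space \<nu>"
      using A by auto
    fix i
    have "emeasure pairs (A i \<times> space \<nu>) = (\<integral>\<^sup>+ x. indicator (A i) x * emeasure (m x) (space \<nu>) \<partial>\<nu>)"
      using A by (intro emeasure_pairs_Times) auto
    also have "\<dots> \<le> (\<integral>\<^sup>+ x. indicator (A i) x \<partial>\<nu>)"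
      using prob_space_kernel
      by (intro nn_integral_mono) (auto simp: indicator_def prob_space.emeasure_le_1)
    also have "\<dots> < \<infinity>" using A by (subst nn_integral_indicator) (auto simp: less_top)
    finally show "emeasure pairs (A i \<times> space \<nu>) \<noteq> \<infinity>" by simp
  next
    fix X assume "X \<in> ?E"
    then obtain a b where X: "X = a \<times> b" and [measurable]: "a \<in> sets \<nu>" "b \<in> sets \<nu>" by auto
    have "(\<lambda>(x, y). (y, x)) -` X \<inter> space pairs = b \<times> a"
      using X sets.sets_into_space[of a \<nu>] sets.sets_into_space[of b \<nu>] by (auto simp: space_pairs)
    then have "emeasure (distr pairs (\<nu> \<Otimes>\<^sub>M \<nu>) (\<lambda>(x, y). (y, x))) X = emeasure pairs (b \<times> a)"
      unfolding X by (subst emeasure_distr) auto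
    also have "\<dots> = emeasure pairs X"
      using rev by (simp add: X emeasure_pairs_Times reversible_def)
    finally show "emeasure pairs X = emeasure (distr pairs (\<nu> \<Otimes>\<^sub>M \<nu>) (\<lambda>(x, y). (y, x))) X" ..
  qed
  then show ?thesis ..
qed

lemma
  fixes f :: "_ \<Rightarrow> real"
  assumes f: "integrable pairs f"
  shows integrable_pairs_swap: "integrable pairs (\<lambda>z. f (snd z, fst z))"
    and integral_pairs_swap: "(\<integral>z. f (snd z, fst z) \<partial>pairs) = (\<integral>z. f z \<partial>pairs)"
proof -
  have [measurable]: "f \<in> borel_measurable (\<nu> \<Otimes>\<^sub>M \<nu>)"
    using borel_measurable_integrable[OF f] by simp
  have "integrable (distr pairs (\<nu> \<Otimes>\<^sub>M \<nu>) (\<lambda>(x, y). (y, x))) f"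
    using f by (simp add: distr_swap_pairs)
  then show "integrable pairs (\<lambda>z. f (snd z, fst z))"
    by (subst (asm) integrable_distr_eq) (auto simp: case_prod_beta)
  have "(\<integral>z. f z \<partial>pairs) = (\<integral>z. f z \<partial>distr pairs (\<nu> \<Otimes>\<^sub>M \<nu>) (\<lambda>(x, y). (y, x)))"
    by (simp add: distr_swap_pairs)
  also have "\<dots> = (\<integral>z. f (case z of (x, y) \<Rightarrow> (y, x)) \<partial>pairs)"
    by (intro integral_distr) auto
  finally show "(\<integral>z. f (snd z, fst z) \<partial>pairs) = (\<integral>z. f z \<partial>pairs)" by (simp add: case_prod_beta)
qed

lemma AE_integrable_kernel:
  fixes f :: "_ \<Rightarrow> real"
  assumes f: "integrable pairs f"
  shows "AE x in \<nu>. integrable (m x) (\<lambda>y. f (x, y))"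
proof -
  have [measurable]: "f \<in> borel_measurable (\<nu> \<Otimes>\<^sub>M \<nu>)"
    using borel_measurable_integrable[OF f] by simp
  have "(\<integral>\<^sup>+x. (\<integral>\<^sup>+y. ennreal \<bar>f (x, y)\<bar> \<partial>m x) \<partial>\<nu>) < \<infinity>"
    using f nn_integral_pairs[of "\<lambda>z. ennreal \<bar>f z\<bar>"] by (simp add: integrable_iff_bounded)
  then have "AE x in \<nu>. (\<integral>\<^sup>+y. ennreal \<bar>f (x, y)\<bar> \<partial>m x) \<noteq> \<infinity>"
    using nn_integral_kernel_measurable[of "\<lambda>z. ennreal \<bar>f z\<bar>"]
    by (intro nn_integral_PInf_AE) auto
  then show ?thesis
    using AE_space by eventually_elim
      (auto simp: integrable_iff_bounded less_top intro: section_measurable)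
qed

text \<open>Fubini for the kernel. Only almost every section is integrable, so the identity is
  proved for positive and negative parts and carried over to f along an almost everywhere
  equality.\<close>

lemma
  fixes f :: "_ \<Rightarrow> real"
  assumes f: "integrable pairs f"
  shows integrable_integral_kernel: "integrable \<nu> (\<lambda>x. \<integral>y. f (x, y) \<partial>m x)"
    and integral_pairs: "(\<integral>z. f z \<partial>pairs) = (\<integral>x. (\<integral>y. f (x, y) \<partial>m x) \<partial>\<nu>)"
proof -
  have [measurable]: "f \<in> borel_measurable (\<nu> \<Otimes>\<^sub>M \<nu>)"
    using borel_measurable_integrable[OF f] by simp
  have pos: "has_bochner_integral \<nu> (\<lambda>x. \<integral>y. g (x, y) \<partial>m x) (\<integral>z. g z \<partial>pairs)"
    if g: "integrable pairs g" "\<And>z. 0 \<le> g z" for g :: "_ \<Rightarrow> real"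
  proof (rule has_bochner_integral_nn_integral)
    have [measurable]: "g \<in> borel_measurable (\<nu> \<Otimes>\<^sub>M \<nu>)"
      using borel_measurable_integrable[OF g(1)] by simp
    show "(\<lambda>x. \<integral>y. g (x, y) \<partial>m x) \<in> borel_measurable \<nu>"
      by (rule integral_kernel_measurable) measurable
    have "(\<integral>\<^sup>+ x. ennreal (\<integral>y. g (x, y) \<partial>m x) \<partial>\<nu>) = (\<integral>\<^sup>+ x. (\<integral>\<^sup>+y. ennreal (g (x, y)) \<partial>m x) \<partial>\<nu>)"
      using AE_integrable_kernel[OF g(1)]
      by (intro nn_integral_cong_AE, eventually_elim) (simp add: nn_integral_eq_integral g(2))
    also have "\<dots> = (\<integral>\<^sup>+ z. ennreal (g z) \<partial>pairs)" by (simp add: nn_integral_pairs)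
    also have "\<dots> = ennreal (\<integral>z. g z \<partial>pairs)"
      using g by (intro nn_integral_eq_integral) auto
    finally show "(\<integral>\<^sup>+ x. ennreal (\<integral>y. g (x, y) \<partial>m x) \<partial>\<nu>) = ennreal (\<integral>z. g z \<partial>pairs)" .
  qed (auto simp: g(2) intro!: integral_nonneg_AE)
  have p: "integrable pairs (\<lambda>z. max 0 (f z))" "integrable pairs (\<lambda>z. max 0 (- f z))"
    using f by auto
  have "has_bochner_integral \<nu>
     (\<lambda>x. (\<integral>y. max 0 (f (x, y)) \<partial>m x) - (\<integral>y. max 0 (- f (x, y)) \<partial>m x))
     ((\<integral>z. max 0 (f z) \<partial>pairs) - (\<integral>z. max 0 (- f z) \<partial>pairs))"
    using pos[OF p(1)] pos[OF p(2)] by (intro has_bochner_integral_diff) auto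
  also have "(\<integral>z. max 0 (f z) \<partial>pairs) - (\<integral>z. max 0 (- f z) \<partial>pairs) = (\<integral>z. f z \<partial>pairs)"
    unfolding Bochner_Integration.integral_diff[OF p, symmetric]
    by (intro Bochner_Integration.integral_cong) (auto simp: max_def)
  finally have H: "has_bochner_integral \<nu>
     (\<lambda>x. (\<integral>y. max 0 (f (x, y)) \<partial>m x) - (\<integral>y. max 0 (- f (x, y)) \<partial>m x)) (\<integral>z. f z \<partial>pairs)" .
  have "AE x in \<nu>. (\<integral>y. max 0 (f (x, y)) \<partial>m x) - (\<integral>y. max 0 (- f (x, y)) \<partial>m x) = (\<integral>y. f (x, y) \<partial>m x)"
    using AE_integrable_kernel[OF f]
  proof eventually_elim
    case (elim x)
    then have p: "integrable (m x) (\<lambda>y. max 0 (f (x, y)))" "integrable (m x) (\<lambda>y. max 0 (- f (x, y)))"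
      by auto
    show ?case
      unfolding Bochner_Integration.integral_diff[OF p, symmetric]
      by (intro Bochner_Integration.integral_cong) (auto simp: max_def)
  qed
  then have "has_bochner_integral \<nu> (\<lambda>x. \<integral>y. f (x, y) \<partial>m x) (\<integral>z. f z \<partial>pairs)"
    using borel_measurable_has_bochner_integral[OF H] H
    by (subst (asm) has_bochner_integral_cong_AE) (simp_all add: integral_kernel_measurable)
  then show "integrable \<nu> (\<lambda>x. \<integral>y. f (x, y) \<partial>m x)"
    "(\<integral>z. f z \<partial>pairs) = (\<integral>x. (\<integral>y. f (x, y) \<partial>m x) \<partial>\<nu>)"
    by (auto simp: has_bochner_integral_iff)
qed

end

section \<open>Energies and nonlocal Laplacians\<close>

definition grad :: "('a \<Rightarrow> real) \<Rightarrow> 'a \<times> 'a \<Rightarrow> real" where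
  "grad u z = u (snd z) - u (fst z)"

lemma grad_Pair: "grad u (x, y) = u y - u x"
  by (simp add: grad_def)

lemma grad_swap: "grad u (y, x) = - grad u (x, y)"
  by (simp add: grad_def)

section \<open>Square integrable functions\<close>

lemma L2_D: "u \<in> L2 M \<Longrightarrow> u \<in> borel_measurable M" "u \<in> L2 M \<Longrightarrow> integrable M (\<lambda>x. (u x)\<^sup>2)"
  by (auto simp: L2_def)

lemma L2_mult_integrable:
  assumes "u \<in> L2 M" "v \<in> L2 M" shows "integrable M (\<lambda>x. u x * v x)"
proof (rule Bochner_Integration.integrable_bound)
  show "integrable M (\<lambda>x. (u x)\<^sup>2 + (v x)\<^sup>2)" using assms by (auto simp: L2_def)
  show "(\<lambda>x. u x * v x) \<in> borel_measurable M" using assms by (auto simp: L2_def)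
  have "\<bar>a * b\<bar> \<le> a\<^sup>2 + b\<^sup>2" for a b :: real
  proof -
    have "2 * \<bar>a\<bar> * \<bar>b\<bar> \<le> a\<^sup>2 + b\<^sup>2" using sum_squares_bound[of "\<bar>a\<bar>" "\<bar>b\<bar>"] by simp
    moreover have "0 \<le> \<bar>a\<bar> * \<bar>b\<bar>" by simp
    ultimately show ?thesis unfolding abs_mult by linarith
  qed
  then show "AE x in M. norm (u x * v x) \<le> norm ((u x)\<^sup>2 + (v x)\<^sup>2)" by simp
qed

lemma L2_dominated:
  assumes "u \<in> borel_measurable M" "integrable M g" "AE x in M. (u x)\<^sup>2 \<le> g x"
  shows "u \<in> L2 M"
  unfolding L2_def using assms
  by (auto intro!: Bochner_Integration.integrable_bound[of M g "\<lambda>x. (u x)\<^sup>2"])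

lemma L2_add: assumes "u \<in> L2 M" "v \<in> L2 M" shows "(\<lambda>x. u x + v x) \<in> L2 M"
proof (rule L2_dominated)
  show "integrable M (\<lambda>x. 2 * (u x)\<^sup>2 + 2 * (v x)\<^sup>2)" using assms by (auto simp: L2_def)
  have "(a + b)\<^sup>2 \<le> 2 * a\<^sup>2 + 2 * b\<^sup>2" for a b :: real
    using sum_squares_bound[of a b] by (simp add: power2_sum)
  then show "AE x in M. (u x + v x)\<^sup>2 \<le> 2 * (u x)\<^sup>2 + 2 * (v x)\<^sup>2" by simp
qed (use assms in \<open>auto simp: L2_def\<close>)

lemma L2_cmult: "u \<in> L2 M \<Longrightarrow> (\<lambda>x. a * u x) \<in> L2 M"
  by (auto simp: L2_def power_mult_distrib)

lemma L2_diff: "u \<in> L2 M \<Longrightarrow> v \<in> L2 M \<Longrightarrow> (\<lambda>x. u x - v x) \<in> L2 M"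
  using L2_add[OF _ L2_cmult[of v M "-1"], of u] by simp

context reversible_walk
begin

lemma grad_measurable [measurable]:
  assumes [measurable]: "u \<in> borel_measurable \<nu>"
  shows "grad u \<in> borel_measurable (\<nu> \<Otimes>\<^sub>M \<nu>)"
  unfolding grad_def[abs_def] by measurable

lemma integrable_pairs_fst: 
  fixes g :: "_ \<Rightarrow> real"
  assumes g: "integrable \<nu> g" shows "integrable pairs (\<lambda>z. g (fst z))"
proof -
  have [measurable]: "g \<in> borel_measurable \<nu>" using g by auto
  show ?thesis
    using g nn_integral_pairs_fst[of "\<lambda>x. ennreal \<bar>g x\<bar>"] by (simp add: integrable_iff_bounded)
qed

text \<open>The first marginal of \<open>pairs\<close> is \<nu> because the kernels have mass one;
  the symmetry then makes the second marginal \<nu> as well.\<close>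

lemma integrable_pairs_snd:
  fixes g :: "_ \<Rightarrow> real"
  assumes g: "integrable \<nu> g" shows "integrable pairs (\<lambda>z. g (snd z))"
  using integrable_pairs_swap[OF integrable_pairs_fst[OF g]] by simp

section \<open>Energies as integrals over pairs\<close>

lemma grad_energy_pairs:
  assumes [measurable]: "u \<in> borel_measurable \<nu>"
  shows "grad_energy m \<nu> s u = (\<integral>\<^sup>+z. ennreal (\<bar>grad u z\<bar> powr s) \<partial>pairs)"
  by (subst nn_integral_pairs) (auto simp: grad_energy_def grad_Pair)

lemma grad_energy_finite_iff:
  assumes [measurable]: "u \<in> borel_measurable \<nu>"
  shows "grad_energy m \<nu> s u < \<infinity> \<longleftrightarrow> integrable pairs (\<lambda>z. \<bar>grad u z\<bar> powr s)"
  by (simp add: grad_energy_pairs integrable_iff_bounded)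

lemma energy_eq:
  assumes [measurable]: "u \<in> borel_measurable \<nu>" and "integrable pairs (\<lambda>z. \<bar>grad u z\<bar> powr s)"
  shows "energy m \<nu> s u = ereal ((\<integral>z. \<bar>grad u z\<bar> powr s \<partial>pairs) / (2 * s))"
  using assms(2) unfolding energy_def grad_energy_pairs[OF assms(1)]
  by (subst nn_integral_eq_integral) (auto simp: enn2ereal_ennreal)

lemma energy_finite_iff:
  assumes "0 < s" shows "energy m \<nu> s u < \<infinity> \<longleftrightarrow> grad_energy m \<nu> s u < \<infinity>"
  using assms by (cases "grad_energy m \<nu> s u" rule: ennreal_cases) (auto simp: energy_def enn2ereal_ennreal)

lemma energy_nonneg: "0 < s \<Longrightarrow> 0 \<le> energy m \<nu> s u"
  by (auto simp: energy_def)

lemma integrable_grad_powr_of_powr: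
  assumes [measurable]: "\<phi> \<in> borel_measurable \<nu>" and s: "0 < s" and i: "integrable \<nu> (\<lambda>x. \<bar>\<phi> x\<bar> powr s)"
  shows "integrable pairs (\<lambda>z. \<bar>grad \<phi> z\<bar> powr s)"
proof (rule Bochner_Integration.integrable_bound)
  show "integrable pairs (\<lambda>z. 2 powr s * (\<bar>\<phi> (snd z)\<bar> powr s + \<bar>\<phi> (fst z)\<bar> powr s))"
    using integrable_pairs_fst[OF i] integrable_pairs_snd[OF i] by simp
  show "AE z in pairs. norm (\<bar>grad \<phi> z\<bar> powr s) \<le> norm (2 powr s * (\<bar>\<phi> (snd z)\<bar> powr s + \<bar>\<phi> (fst z)\<bar> powr s))"
    using powr_abs_add_le[OF s, of "\<phi> (snd z)" "- \<phi> (fst z)" for z] by (simp add: grad_def)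
qed measurable

lemma integrable_grad_powr_add:
  assumes [measurable]: "u \<in> borel_measurable \<nu>" "w \<in> borel_measurable \<nu>" and s: "0 < s"
    and i: "integrable pairs (\<lambda>z. \<bar>grad u z\<bar> powr s)" "integrable pairs (\<lambda>z. \<bar>grad w z\<bar> powr s)"
  shows "integrable pairs (\<lambda>z. \<bar>grad u z + t * grad w z\<bar> powr s)"
proof (rule Bochner_Integration.integrable_bound)
  show "integrable pairs (\<lambda>z. 2 powr s * (\<bar>grad u z\<bar> powr s + \<bar>t\<bar> powr s * \<bar>grad w z\<bar> powr s))"
    using i by simp
  show "AE z in pairs. norm (\<bar>grad u z + t * grad w z\<bar> powr s)
      \<le> norm (2 powr s * (\<bar>grad u z\<bar> powr s + \<bar>t\<bar> powr s * \<bar>grad w z\<bar> powr s))"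
    using powr_abs_add_le[OF s, of "grad u z" "t * grad w z" for z] by (simp add: abs_mult powr_mult)
qed measurable

lemma integrable_signed_power_mult:
  assumes [measurable]: "f \<in> borel_measurable (\<nu> \<Otimes>\<^sub>M \<nu>)" "g \<in> borel_measurable (\<nu> \<Otimes>\<^sub>M \<nu>)" and s: "1 < s"
    and i: "integrable pairs (\<lambda>z. \<bar>f z\<bar> powr s)" "integrable pairs (\<lambda>z. \<bar>g z\<bar> powr s)"
  shows "integrable pairs (\<lambda>z. signed_power s (f z) * g z)"
proof (rule Bochner_Integration.integrable_bound)
  show "integrable pairs (\<lambda>z. \<bar>f z\<bar> powr s + \<bar>g z\<bar> powr s)" using i by simp
  show "AE z in pairs. norm (signed_power s (f z) * g z) \<le> norm (\<bar>f z\<bar> powr s + \<bar>g z\<bar> powr s)"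
    using abs_signed_power_mult_le[OF s] by simp
qed measurable

text \<open>Exchanging coordinates turns f(x, y) \<phi>(y) into -f(x, y) \<phi>(x), so the two
  halves of the gradient contribute equally; hence the factor -2. Only the product of f and \<phi>
  has to be integrable, not f itself.\<close>

lemma
  fixes f :: "_ \<Rightarrow> real"
  assumes f[measurable]: "f \<in> borel_measurable (\<nu> \<Otimes>\<^sub>M \<nu>)" and antisym: "\<And>x y. f (y, x) = - f (x, y)"
    and i: "integrable pairs (\<lambda>z. f z * \<phi> (fst z))"
  shows integrable_kernel_mult: "integrable \<nu> (\<lambda>x. (\<integral>y. f (x, y) \<partial>m x) * \<phi> x)"
    and integral_antisym_grad:
      "(\<integral>z. f z * grad \<phi> z \<partial>pairs) = - 2 * (\<integral>x. (\<integral>y. f (x, y) \<partial>m x) * \<phi> x \<partial>\<nu>)"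
proof -
  have swap: "f (snd z, fst z) * \<phi> (snd z) = - (f z * \<phi> (snd z))" for z
    using antisym[of "fst z" "snd z"] by simp
  have i2: "integrable pairs (\<lambda>z. f z * \<phi> (snd z))"
    using integrable_pairs_swap[OF i] by (simp add: swap)
  have "(\<integral>z. f z * \<phi> (snd z) \<partial>pairs) = - (\<integral>z. f z * \<phi> (fst z) \<partial>pairs)"
    using integral_pairs_swap[OF i] by (simp add: swap)
  then have "(\<integral>z. f z * grad \<phi> z \<partial>pairs) = - 2 * (\<integral>z. f z * \<phi> (fst z) \<partial>pairs)"
    using i i2 by (simp add: grad_def right_diff_distrib)
  then show "(\<integral>z. f z * grad \<phi> z \<partial>pairs) = - 2 * (\<integral>x. (\<integral>y. f (x, y) \<partial>m x) * \<phi> x \<partial>\<nu>)"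
    using integral_pairs[OF i] by simp
  show "integrable \<nu> (\<lambda>x. (\<integral>y. f (x, y) \<partial>m x) * \<phi> x)"
    using integrable_integral_kernel[OF i] by simp
qed

text \<open>A total function: where the section is not integrable its value is 0 by default, in
  agreement with the integral in \<open>p_laplacian\<close>.\<close>

definition laplace :: "real \<Rightarrow> ('a \<Rightarrow> real) \<Rightarrow> 'a \<Rightarrow> real" where
  "laplace s u x = (\<integral>y. signed_power s (grad u (x, y)) \<partial>m x)"

lemma laplace_measurable [measurable]: "u \<in> borel_measurable \<nu> \<Longrightarrow> laplace s u \<in> borel_measurable \<nu>"
  unfolding laplace_def
  using integral_kernel_measurable[of "\<lambda>z. signed_power s (grad u z)"] by simp

lemma p_laplacian_iff:
  "(u, w) \<in> p_laplacian m \<nu> s \<longleftrightarrow> u \<in> L2 \<nu> \<and> w \<in> L2 \<nu> \<and>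
     integrable pairs (\<lambda>z. \<bar>grad u z\<bar> powr s) \<and> (AE x in \<nu>. w x = laplace s u x)"
  using grad_energy_finite_iff[of u s]
  by (auto simp: p_laplacian_def laplace_def signed_power_def grad_Pair L2_def)

text \<open>An L^s test function can be paired on \<open>pairs\<close> with the signed power of an
  L^s gradient. Square integrability of the Laplacian is not assumed, so the formula is available
  before that regularity has been shown.\<close>

lemma
  assumes [measurable]: "u \<in> borel_measurable \<nu>" "\<phi> \<in> borel_measurable \<nu>" and s: "1 < s"
    and u: "integrable pairs (\<lambda>z. \<bar>grad u z\<bar> powr s)" and \<phi>: "integrable \<nu> (\<lambda>x. \<bar>\<phi> x\<bar> powr s)"
  shows integrable_laplace_mult: "integrable \<nu> (\<lambda>x. laplace s u x * \<phi> x)"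
    and laplace_by_parts: "(\<integral>z. signed_power s (grad u z) * grad \<phi> z \<partial>pairs) = - 2 * (\<integral>x. laplace s u x * \<phi> x \<partial>\<nu>)"
proof -
  have i: "integrable pairs (\<lambda>z. signed_power s (grad u z) * \<phi> (fst z))"
    using integrable_pairs_fst[OF \<phi>] by (intro integrable_signed_power_mult s u) auto
  have a: "signed_power s (grad u (y, x)) = - signed_power s (grad u (x, y))" for x y
    by (simp add: grad_swap[of u y x])
  show "integrable \<nu> (\<lambda>x. laplace s u x * \<phi> x)"
    using integrable_kernel_mult[OF _ a i] by (simp add: laplace_def)
  show "(\<integral>z. signed_power s (grad u z) * grad \<phi> z \<partial>pairs) = - 2 * (\<integral>x. laplace s u x * \<phi> x \<partial>\<nu>)"
    using integral_antisym_grad[OF _ a i] by (simp add: laplace_def)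
qed

section \<open>Integration by parts against square integrable test functions\<close>

lemma abs_grad_trunc_le: "\<bar>grad (\<lambda>x. trunc n (\<phi> x)) z\<bar> \<le> \<bar>grad \<phi> z\<bar>"
  by (simp add: grad_def abs_trunc_diff_le)

lemma integrable_trunc_powr:
  assumes "\<phi> \<in> L2 \<nu>" "0 < r" shows "integrable \<nu> (\<lambda>x. \<bar>trunc n (\<phi> x)\<bar> powr r)"
proof (rule Bochner_Integration.integrable_bound)
  show "integrable \<nu> (\<lambda>x. real n powr r * (real n)\<^sup>2 * (\<phi> x)\<^sup>2)" using assms by (auto simp: L2_def)
  show "(\<lambda>x. \<bar>trunc n (\<phi> x)\<bar> powr r) \<in> borel_measurable \<nu>"
    using L2_D(1)[OF assms(1)] by measurable
qed (use trunc_powr_le[OF assms(2)] in simp)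

text \<open>Since \<phi> need not lie in L^s, the two halves of its gradient cannot be separated;
  its truncations allow this. Both sides pass to the limit by domination: on the left because
  truncation does not increase gradients, on the right because it does not increase moduli and w,
  \<phi> are square integrable.\<close>

lemma laplace_by_parts_L2:
  assumes s: "1 < s" and u: "(u, w) \<in> p_laplacian m \<nu> s"
    and \<phi>: "\<phi> \<in> L2 \<nu>" "integrable pairs (\<lambda>z. \<bar>grad \<phi> z\<bar> powr s)"
  shows "(\<integral>z. signed_power s (grad u z) * grad \<phi> z \<partial>pairs) = - 2 * (\<integral>x. w x * \<phi> x \<partial>\<nu>)"
proof -
  have [measurable]: "u \<in> borel_measurable \<nu>" "\<phi> \<in> borel_measurable \<nu>" "w \<in> borel_measurable \<nu>"
    using u \<phi> by (auto simp: p_laplacian_iff L2_def)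
  have w: "AE x in \<nu>. w x = laplace s u x" "w \<in> L2 \<nu>" and iu: "integrable pairs (\<lambda>z. \<bar>grad u z\<bar> powr s)"
    using u by (auto simp: p_laplacian_iff)
  have "(\<lambda>n. \<integral>z. signed_power s (grad u z) * grad (\<lambda>x. trunc n (\<phi> x)) z \<partial>pairs)
    \<longlonglongrightarrow> (\<integral>z. signed_power s (grad u z) * grad \<phi> z \<partial>pairs)"
  proof (rule integral_dominated_convergence)
    show "integrable pairs (\<lambda>z. norm (signed_power s (grad u z) * grad \<phi> z))"
      by (intro integrable_norm integrable_signed_power_mult s iu \<phi>) auto
    show "AE z in pairs. (\<lambda>n. signed_power s (grad u z) * grad (\<lambda>x. trunc n (\<phi> x)) z)
        \<longlonglongrightarrow> signed_power s (grad u z) * grad \<phi> z"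
      unfolding grad_def by (intro AE_I2 tendsto_intros trunc_tendsto)
    show "AE z in pairs. norm (signed_power s (grad u z) * grad (\<lambda>x. trunc n (\<phi> x)) z)
        \<le> norm (signed_power s (grad u z) * grad \<phi> z)" for n
      using abs_grad_trunc_le by (auto simp: abs_mult intro!: mult_left_mono AE_I2)
  qed measurable
  moreover have "(\<integral>z. signed_power s (grad u z) * grad (\<lambda>x. trunc n (\<phi> x)) z \<partial>pairs) =
      - 2 * (\<integral>x. w x * trunc n (\<phi> x) \<partial>\<nu>)" for n
  proof -
    have "(\<integral>x. laplace s u x * trunc n (\<phi> x) \<partial>\<nu>) = (\<integral>x. w x * trunc n (\<phi> x) \<partial>\<nu>)"
      using w by (intro integral_cong_AE) auto
    then show ?thesis
      using laplace_by_parts[OF _ _ s iu, of "\<lambda>x. trunc n (\<phi> x)"] integrable_trunc_powr[OF \<phi>(1)] s by simp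
  qed
  moreover have "(\<lambda>n. - 2 * (\<integral>x. w x * trunc n (\<phi> x) \<partial>\<nu>)) \<longlonglongrightarrow> - 2 * (\<integral>x. w x * \<phi> x \<partial>\<nu>)"
  proof (intro tendsto_mult tendsto_const integral_dominated_convergence)
    show "integrable \<nu> (\<lambda>x. norm (w x * \<phi> x))"
      by (intro integrable_norm L2_mult_integrable w \<phi>)
    show "AE x in \<nu>. (\<lambda>n. w x * trunc n (\<phi> x)) \<longlonglongrightarrow> w x * \<phi> x"
      by (intro AE_I2 tendsto_intros trunc_tendsto)
    show "AE x in \<nu>. norm (w x * trunc n (\<phi> x)) \<le> norm (w x * \<phi> x)" for n
      using abs_trunc_le(1) by (auto simp: abs_mult intro!: mult_left_mono AE_I2)
  qed measurable
  ultimately show ?thesis using LIMSEQ_unique by auto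
qed

text \<open>The integrated tangent inequality. It serves with u as base point for the subgradient
  inequality, and with a displaced base point for the upper bound on increments.\<close>

lemma energy_diff_ge:
  assumes [measurable]: "u \<in> borel_measurable \<nu>" "w \<in> borel_measurable \<nu>" and s: "1 < s"
    and u: "integrable pairs (\<lambda>z. \<bar>grad u z\<bar> powr s)" and w: "integrable pairs (\<lambda>z. \<bar>grad w z\<bar> powr s)"
  shows "(\<integral>z. \<bar>grad u z\<bar> powr s \<partial>pairs) / (2 * s) + (\<integral>z. signed_power s (grad u z) * grad (\<lambda>x. w x - u x) z \<partial>pairs) / 2
    \<le> (\<integral>z. \<bar>grad w z\<bar> powr s \<partial>pairs) / (2 * s)"
proof -
  have g: "grad (\<lambda>x. w x - u x) z = grad w z - grad u z" for z by (simp add: grad_def)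
  have i: "integrable pairs (\<lambda>z. signed_power s (grad u z) * grad (\<lambda>x. w x - u x) z)"
    using integrable_grad_powr_add[OF _ _ _ w u, of "-1"] s
    by (intro integrable_signed_power_mult s u) (auto simp: g)
  have "(\<integral>z. \<bar>grad u z\<bar> powr s + s * (signed_power s (grad u z) * grad (\<lambda>x. w x - u x) z) \<partial>pairs)
      \<le> (\<integral>z. \<bar>grad w z\<bar> powr s \<partial>pairs)"
    using u w i by (intro integral_mono) (auto simp: g intro: powr_abs_tangent_le s)
  then have "(\<integral>z. \<bar>grad u z\<bar> powr s \<partial>pairs) + s * (\<integral>z. signed_power s (grad u z) * grad (\<lambda>x. w x - u x) z \<partial>pairs)
      \<le> (\<integral>z. \<bar>grad w z\<bar> powr s \<partial>pairs)"
    using u i by simp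
  from divide_right_mono[OF this, of "2 * s"] show ?thesis using s by (simp add: field_simps)
qed

lemma energy_ge_of_p_laplacian:
  assumes s: "1 < s" and u: "(u, l) \<in> p_laplacian m \<nu> s" and w: "w \<in> L2 \<nu>"
  shows "energy m \<nu> s u + ereal (- (\<integral>x. l x * (w x - u x) \<partial>\<nu>)) \<le> energy m \<nu> s w"
proof (cases "grad_energy m \<nu> s w < \<infinity>")
  case True
  have uL: "u \<in> L2 \<nu>" and iu: "integrable pairs (\<lambda>z. \<bar>grad u z\<bar> powr s)"
    using u by (auto simp: p_laplacian_iff)
  have [measurable]: "u \<in> borel_measurable \<nu>" "w \<in> borel_measurable \<nu>" using uL w by (auto simp: L2_def)
  have iw: "integrable pairs (\<lambda>z. \<bar>grad w z\<bar> powr s)" using True grad_energy_finite_iff[of w s] by simp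
  have g: "grad (\<lambda>x. w x - u x) z = grad w z + (-1) * grad u z" for z by (simp add: grad_def)
  have "integrable pairs (\<lambda>z. \<bar>grad (\<lambda>x. w x - u x) z\<bar> powr s)"
    unfolding g using s by (intro integrable_grad_powr_add iw iu) auto
  then have "(\<integral>z. signed_power s (grad u z) * grad (\<lambda>x. w x - u x) z \<partial>pairs) = - 2 * (\<integral>x. l x * (w x - u x) \<partial>\<nu>)"
    by (intro laplace_by_parts_L2 s u L2_diff w uL)
  then show ?thesis
    using energy_diff_ge[OF _ _ s iu iw] by (simp add: energy_eq iu iw)
next
  case False
  then have "energy m \<nu> s w = \<infinity>" using energy_finite_iff[of s w] s by (auto simp: less_top)
  then show ?thesis by simp
qed

text \<open>Only an upper bound for the increment is required, and convexity gives it with the slope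
  taken at the far end u + \<phi>/(n+1). Continuity of the signed power identifies the limit of
  these slopes.\<close>

lemma energy_directional:
  assumes [measurable]: "u \<in> borel_measurable \<nu>" "\<phi> \<in> borel_measurable \<nu>" and s: "1 < s"
    and u: "integrable pairs (\<lambda>z. \<bar>grad u z\<bar> powr s)" and \<phi>: "integrable \<nu> (\<lambda>x. \<bar>\<phi> x\<bar> powr s)"
  obtains R where "\<And>n. energy m \<nu> s (\<lambda>x. u x + \<phi> x / real (Suc n)) \<le> energy m \<nu> s u + ereal (R n / real (Suc n))"
    and "R \<longlonglongrightarrow> - (\<integral>x. laplace s u x * \<phi> x \<partial>\<nu>)"
proof
  define R where "R n = (\<integral>z. signed_power s (grad u z + 1 / real (Suc n) * grad \<phi> z) * grad \<phi> z \<partial>pairs) / 2" for n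
  have i\<phi>: "integrable pairs (\<lambda>z. \<bar>grad \<phi> z\<bar> powr s)"
    using s by (intro integrable_grad_powr_of_powr \<phi>) auto
  have iu: "integrable pairs (\<lambda>z. \<bar>grad u z + t * grad \<phi> z\<bar> powr s)" for t
    using s by (intro integrable_grad_powr_add u i\<phi>) auto
  show "energy m \<nu> s (\<lambda>x. u x + \<phi> x / real (Suc n)) \<le> energy m \<nu> s u + ereal (R n / real (Suc n))" for n
  proof -
    define t where "t = 1 / real (Suc n)"
    let ?w = "\<lambda>x. u x + t * \<phi> x"
    have g: "grad ?w z = grad u z + t * grad \<phi> z" "grad (\<lambda>x. u x - ?w x) z = - t * grad \<phi> z" for z
      by (simp_all add: grad_def algebra_simps)
    have iw: "integrable pairs (\<lambda>z. \<bar>grad ?w z\<bar> powr s)" unfolding g by (rule iu)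
    \<comment> \<open>The base point is the displaced function and the target is u, which reverses
      the sign and bounds the energy of the displaced function from above.\<close>
    have "(\<integral>z. \<bar>grad ?w z\<bar> powr s \<partial>pairs) / (2 * s) +
       (\<integral>z. signed_power s (grad ?w z) * grad (\<lambda>x. u x - ?w x) z \<partial>pairs) / 2
      \<le> (\<integral>z. \<bar>grad u z\<bar> powr s \<partial>pairs) / (2 * s)"
      by (rule energy_diff_ge[OF _ _ s iw u]) auto
    also have "(\<integral>z. signed_power s (grad ?w z) * grad (\<lambda>x. u x - ?w x) z \<partial>pairs) / 2 = - (R n * t)"
    proof -
      have "signed_power s (grad ?w z) * grad (\<lambda>x. u x - ?w x) z =
          - t * (signed_power s (grad u z + t * grad \<phi> z) * grad \<phi> z)" for z
        unfolding g by simp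
      then show ?thesis by (simp add: R_def t_def)
    qed
    finally have "energy m \<nu> s ?w \<le> energy m \<nu> s u + ereal (R n * t)"
      by (simp add: energy_eq iw u)
    then show ?thesis by (simp add: t_def mult.commute)
  qed
  have "(\<lambda>n. \<integral>z. signed_power s (grad u z + 1 / real (Suc n) * grad \<phi> z) * grad \<phi> z \<partial>pairs)
    \<longlonglongrightarrow> (\<integral>z. signed_power s (grad u z) * grad \<phi> z \<partial>pairs)"
  proof (rule integral_dominated_convergence)
    show "integrable pairs (\<lambda>z. 2 powr s * (\<bar>grad u z\<bar> powr s + \<bar>grad \<phi> z\<bar> powr s) + \<bar>grad \<phi> z\<bar> powr s)"
      using u i\<phi> by simp
    show "AE z in pairs. (\<lambda>n. signed_power s (grad u z + 1 / real (Suc n) * grad \<phi> z) * grad \<phi> z)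
        \<longlonglongrightarrow> signed_power s (grad u z) * grad \<phi> z"
    proof (intro AE_I2 tendsto_mult tendsto_const)
      fix z
      have "(\<lambda>n. grad u z + 1 / real (Suc n) * grad \<phi> z) \<longlonglongrightarrow> grad u z + 0 * grad \<phi> z"
        using LIMSEQ_Suc[OF lim_1_over_n] by (intro tendsto_intros) auto
      then have "(\<lambda>n. grad u z + 1 / real (Suc n) * grad \<phi> z) \<longlonglongrightarrow> grad u z" by simp
      then show "(\<lambda>n. signed_power s (grad u z + 1 / real (Suc n) * grad \<phi> z)) \<longlonglongrightarrow> signed_power s (grad u z)"
        by (rule isCont_tendsto_compose[OF isCont_signed_power[OF s]])
    qed
    fix n
    \<comment> \<open>Since the step 1/(n+1) is at most 1, the displaced gradient has a bound
      independent of n; the last summand comes from the crude Young estimate.\<close>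
    have "\<bar>signed_power s (a + 1 / real (Suc n) * b) * b\<bar> \<le> 2 powr s * (\<bar>a\<bar> powr s + \<bar>b\<bar> powr s) + \<bar>b\<bar> powr s" for a b
    proof -
      let ?t = "1 / real (Suc n)"
      have "\<bar>?t * b\<bar> \<le> \<bar>b\<bar>" by (simp add: abs_mult mult_left_le_one_le field_simps)
      then have "\<bar>?t * b\<bar> powr s \<le> \<bar>b\<bar> powr s" using s by (intro powr_mono2) auto
      then have "2 powr s * (\<bar>a\<bar> powr s + \<bar>?t * b\<bar> powr s) \<le> 2 powr s * (\<bar>a\<bar> powr s + \<bar>b\<bar> powr s)" by simp
      then show ?thesis
        using abs_signed_power_mult_le[OF s, of "a + ?t * b" b] powr_abs_add_le[of s a "?t * b"] s by linarith
    qed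
    then show "AE z in pairs. norm (signed_power s (grad u z + 1 / real (Suc n) * grad \<phi> z) * grad \<phi> z)
        \<le> 2 powr s * (\<bar>grad u z\<bar> powr s + \<bar>grad \<phi> z\<bar> powr s) + \<bar>grad \<phi> z\<bar> powr s"
      by simp
  qed measurable
  from tendsto_divide[OF this tendsto_const, of 2]
  show "R \<longlonglongrightarrow> - (\<integral>x. laplace s u x * \<phi> x \<partial>\<nu>)"
    unfolding R_def[abs_def] using laplace_by_parts[OF _ _ s u \<phi>] by simp
qed

text \<open>Jensen in each probability measure m_x. The exponent r = s/(s-1) makes the right-hand
  side the energy integral, and r = 2 gives square integrability for truncations.\<close>

lemma nn_integral_laplace_powr_le:
  assumes [measurable]: "u \<in> borel_measurable \<nu>" and r: "1 < r"
  shows "(\<integral>\<^sup>+x. ennreal (\<bar>laplace s u x\<bar> powr r) \<partial>\<nu>) \<le> (\<integral>\<^sup>+z. ennreal (\<bar>grad u z\<bar> powr ((s - 1) * r)) \<partial>pairs)"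
proof -
  have "ennreal (\<bar>laplace s u x\<bar> powr r) \<le> (\<integral>\<^sup>+y. ennreal (\<bar>signed_power s (grad u (x, y))\<bar> powr r) \<partial>m x)"
    if "x \<in> space \<nu>" for x
  proof (cases "integrable (m x) (\<lambda>y. signed_power s (grad u (x, y)))")
    case True
    then show ?thesis
      unfolding laplace_def by (rule prob_space.powr_abs_expectation_le[OF prob_space_kernel[OF that] r])
  next
    \<comment> \<open>Here the default value 0 of the integral makes the bound trivial.\<close>
    case False
    then show ?thesis by (simp add: laplace_def not_integrable_integral_eq)
  qed
  then have "(\<integral>\<^sup>+x. ennreal (\<bar>laplace s u x\<bar> powr r) \<partial>\<nu>) \<le>
      (\<integral>\<^sup>+x. (\<integral>\<^sup>+y. ennreal (\<bar>signed_power s (grad u (x, y))\<bar> powr r) \<partial>m x) \<partial>\<nu>)"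
    by (rule nn_integral_mono)
  also have "\<dots> = (\<integral>\<^sup>+z. ennreal (\<bar>grad u z\<bar> powr ((s - 1) * r)) \<partial>pairs)"
    by (subst nn_integral_pairs) (simp_all add: abs_signed_power powr_powr)
  finally show ?thesis .
qed

lemma integrable_laplace_powr:
  assumes [measurable]: "u \<in> borel_measurable \<nu>" and r: "1 < r"
    and u: "integrable pairs (\<lambda>z. \<bar>grad u z\<bar> powr ((s - 1) * r))"
  shows "integrable \<nu> (\<lambda>x. \<bar>laplace s u x\<bar> powr r)"
proof -
  have "(\<integral>\<^sup>+z. ennreal (\<bar>grad u z\<bar> powr ((s - 1) * r)) \<partial>pairs) < \<infinity>"
    using u by (simp add: integrable_iff_bounded)
  then show ?thesis
    using nn_integral_laplace_powr_le[OF _ r, of u s] by (simp add: integrable_iff_bounded)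
qed

text \<open>Truncation makes every positive power of the gradient integrable, in particular s for
  the energy and 2(s-1) for a square integrable Laplacian.\<close>

lemma p_laplacian_trunc:
  assumes s: "1 < s" and f: "f \<in> L2 \<nu>"
  shows "((\<lambda>x. trunc n (f x)), laplace s (\<lambda>x. trunc n (f x))) \<in> p_laplacian m \<nu> s"
proof -
  have [measurable]: "f \<in> borel_measurable \<nu>" using f by (simp add: L2_def)
  have "(\<lambda>x. trunc n (f x)) \<in> L2 \<nu>"
    using L2_D(2)[OF f] abs_trunc_le(1) by (intro L2_dominated) (auto simp: abs_le_square_iff[symmetric])
  moreover have "integrable pairs (\<lambda>z. \<bar>grad (\<lambda>x. trunc n (f x)) z\<bar> powr r)" if "0 < r" for r
    using integrable_trunc_powr[OF f that] by (intro integrable_grad_powr_of_powr that) auto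
  moreover from this have "integrable \<nu> (\<lambda>x. \<bar>laplace s (\<lambda>x. trunc n (f x)) x\<bar> powr 2)"
    using s by (intro integrable_laplace_powr) auto
  ultimately show ?thesis using s by (simp add: p_laplacian_iff L2_def)
qed

text \<open>T may jump, so the gradient of T(u1 - u2) is not controlled by that of u1 - u2. The
  quadratic bound on |T|^s instead puts T(u1 - u2) itself into L^s, which suffices for integration
  by parts.\<close>

lemma p_laplacian_T_accretive:
  assumes s: "1 < s" and u1: "(u1, l1) \<in> p_laplacian m \<nu> s" and u2: "(u2, l2) \<in> p_laplacian m \<nu> s"
    and T: "mono T" and T_le: "\<And>a. \<bar>T a\<bar> powr s \<le> K * a\<^sup>2"
  shows "(\<integral>x. (l1 x - l2 x) * T (u1 x - u2 x) \<partial>\<nu>) \<le> 0"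
proof -
  have [measurable]: "u1 \<in> borel_measurable \<nu>" "u2 \<in> borel_measurable \<nu>" "l1 \<in> borel_measurable \<nu>" "l2 \<in> borel_measurable \<nu>"
    and L: "u1 \<in> L2 \<nu>" "u2 \<in> L2 \<nu>"
    and i: "integrable pairs (\<lambda>z. \<bar>grad u1 z\<bar> powr s)" "integrable pairs (\<lambda>z. \<bar>grad u2 z\<bar> powr s)"
    and l: "AE x in \<nu>. l1 x = laplace s u1 x" "AE x in \<nu>. l2 x = laplace s u2 x"
    using u1 u2 by (auto simp: p_laplacian_iff L2_def)
  have [measurable]: "T \<in> borel_measurable borel" using T by (rule borel_measurable_mono)
  let ?\<phi> = "\<lambda>x. T (u1 x - u2 x)"
  have \<phi>: "integrable \<nu> (\<lambda>x. \<bar>?\<phi> x\<bar> powr s)"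
  proof (rule Bochner_Integration.integrable_bound)
    show "integrable \<nu> (\<lambda>x. K * (u1 x - u2 x)\<^sup>2)" using L2_diff[OF L] by (auto simp: L2_def)
    show "AE x in \<nu>. norm (\<bar>?\<phi> x\<bar> powr s) \<le> norm (K * (u1 x - u2 x)\<^sup>2)"
      using T_le by (auto intro!: AE_I2 order_trans[OF T_le abs_ge_self])
  qed measurable
  have i\<phi>: "integrable pairs (\<lambda>z. \<bar>grad ?\<phi> z\<bar> powr s)"
    using s by (intro integrable_grad_powr_of_powr \<phi>) auto
  have "0 \<le> (\<integral>z. (signed_power s (grad u1 z) - signed_power s (grad u2 z)) * grad ?\<phi> z \<partial>pairs)"
  proof (rule integral_nonneg_AE, rule AE_I2)
    fix z
    have m: "0 \<le> (signed_power s (grad u1 z) - signed_power s (grad u2 z)) * (grad u1 z - grad u2 z)"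
      using signed_power_monotone[OF s] .
    have d: "grad u1 z - grad u2 z = (u1 (snd z) - u2 (snd z)) - (u1 (fst z) - u2 (fst z))"
      by (simp add: grad_def)
    have g: "grad ?\<phi> z = T (u1 (snd z) - u2 (snd z)) - T (u1 (fst z) - u2 (fst z))" by (simp add: grad_def)
    \<comment> \<open>Both factors have the weak sign of \<open>grad u1 z - grad u2 z\<close>: one
      since the signed power is monotone, the other since T is. If the gradients agree, the first
      factor vanishes.\<close>
    show "0 \<le> (signed_power s (grad u1 z) - signed_power s (grad u2 z)) * grad ?\<phi> z"
    proof (cases "grad u1 z - grad u2 z" "0::real" rule: linorder_cases)
      case less
      then have "grad ?\<phi> z \<le> 0" using monoD[OF T] by (simp add: d g)
      moreover have "signed_power s (grad u1 z) - signed_power s (grad u2 z) \<le> 0"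
        using m less by (simp add: zero_le_mult_iff)
      ultimately show ?thesis by (rule mult_nonpos_nonpos[rotated])
    next
      case equal
      then show ?thesis by simp
    next
      case greater
      then have "0 \<le> grad ?\<phi> z" using monoD[OF T] by (simp add: d g)
      moreover have "0 \<le> signed_power s (grad u1 z) - signed_power s (grad u2 z)"
        using m greater by (simp add: zero_le_mult_iff)
      ultimately show ?thesis by simp
    qed
  qed
  also have "\<dots> = (\<integral>z. signed_power s (grad u1 z) * grad ?\<phi> z \<partial>pairs) - (\<integral>z. signed_power s (grad u2 z) * grad ?\<phi> z \<partial>pairs)"
    using s i i\<phi> by (simp add: left_diff_distrib integrable_signed_power_mult)
  also have "\<dots> = - 2 * ((\<integral>x. laplace s u1 x * ?\<phi> x \<partial>\<nu>) - (\<integral>x. laplace s u2 x * ?\<phi> x \<partial>\<nu>))"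
    using s i \<phi> by (simp add: laplace_by_parts)
  also have "(\<integral>x. laplace s u1 x * ?\<phi> x \<partial>\<nu>) - (\<integral>x. laplace s u2 x * ?\<phi> x \<partial>\<nu>) =
      (\<integral>x. (laplace s u1 x - laplace s u2 x) * ?\<phi> x \<partial>\<nu>)"
    using s i \<phi> by (simp add: left_diff_distrib integrable_laplace_mult)
  also have "\<dots> = (\<integral>x. (l1 x - l2 x) * ?\<phi> x \<partial>\<nu>)"
    using l by (intro integral_cong_AE) auto
  finally show ?thesis by simp
qed

end

section \<open>Lower semicontinuous convex functions and complete accretivity\<close>

text \<open>The Pasch-Hausdorff envelope, that is, the infimal convolution of j with \<Lambda>|.|.
  Although j may be infinite, \<open>j 0 = 0\<close> and \<Lambda> \<ge> 0 make the infimum finite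
  (take z = 0), so \<open>enn2real\<close> loses nothing.\<close>

definition lipschitz_envelope :: "real \<Rightarrow> (real \<Rightarrow> ennreal) \<Rightarrow> real \<Rightarrow> real" where
  "lipschitz_envelope \<Lambda> j x = enn2real (INF z. j z + ennreal (\<Lambda> * \<bar>x - z\<bar>))"

lemma lipschitz_envelope_le:
  assumes "0 \<le> \<Lambda>" "j 0 = 0"
  shows "ennreal (lipschitz_envelope \<Lambda> j x) \<le> j z + ennreal (\<Lambda> * \<bar>x - z\<bar>)"
    and "ennreal (lipschitz_envelope \<Lambda> j x) = (INF z. j z + ennreal (\<Lambda> * \<bar>x - z\<bar>))"
proof -
  let ?E = "INF z. j z + ennreal (\<Lambda> * \<bar>x - z\<bar>)"
  have "?E \<le> j 0 + ennreal (\<Lambda> * \<bar>x - 0\<bar>)" by (rule INF_lower) simp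
  then have "?E < \<infinity>" using assms by (simp add: le_less_trans)
  then show *: "ennreal (lipschitz_envelope \<Lambda> j x) = ?E" by (simp add: lipschitz_envelope_def)
  show "ennreal (lipschitz_envelope \<Lambda> j x) \<le> j z + ennreal (\<Lambda> * \<bar>x - z\<bar>)"
    unfolding * by (rule INF_lower) simp
qed

lemma lipschitz_envelope_nonneg: "0 \<le> lipschitz_envelope \<Lambda> j x"
  by (simp add: lipschitz_envelope_def)

lemma lipschitz_envelope_le_abs:
  assumes "0 \<le> \<Lambda>" "j 0 = 0" shows "lipschitz_envelope \<Lambda> j x \<le> \<Lambda> * \<bar>x\<bar>"
  using lipschitz_envelope_le(1)[of \<Lambda> j x 0] assms by simp

lemma lipschitz_envelope_approx:
  assumes "0 \<le> \<Lambda>" "j 0 = 0" "0 < e"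
  obtains z r where "0 \<le> r" "j z = ennreal r" "r + \<Lambda> * \<bar>x - z\<bar> < lipschitz_envelope \<Lambda> j x + e"
proof -
  have "ennreal (lipschitz_envelope \<Lambda> j x) < ennreal (lipschitz_envelope \<Lambda> j x + e)"
    using assms lipschitz_envelope_nonneg[of \<Lambda> j x] by (simp add: ennreal_less_iff)
  then have "(INF z. j z + ennreal (\<Lambda> * \<bar>x - z\<bar>)) < ennreal (lipschitz_envelope \<Lambda> j x + e)"
    using lipschitz_envelope_le(2)[of \<Lambda> j x] assms by simp
  then obtain z where z: "j z + ennreal (\<Lambda> * \<bar>x - z\<bar>) < ennreal (lipschitz_envelope \<Lambda> j x + e)"
    by (auto simp: INF_less_iff)
  then obtain r where r: "0 \<le> r" "j z = ennreal r"
    by (cases "j z" rule: ennreal_cases) auto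
  then have "r + \<Lambda> * \<bar>x - z\<bar> < lipschitz_envelope \<Lambda> j x + e"
    using z assms by (simp add: ennreal_less_iff flip: ennreal_plus)
  with r that show ?thesis by blast
qed

text \<open>Near-minimisers for x and y have finite j-values, and their convex combination is a
  competitor for the convex combination of x and y.\<close>

lemma lipschitz_envelope_convex:
  assumes \<Lambda>: "0 \<le> \<Lambda>" and j: "convex_ennreal_fun j" "j 0 = 0"
  shows "convex_on UNIV (lipschitz_envelope \<Lambda> j)"
proof (rule convex_onI)
  fix t x y :: real assume t: "0 < t" "t < 1"
  let ?E = "lipschitz_envelope \<Lambda> j"
  show "?E ((1 - t) *\<^sub>R x + t *\<^sub>R y) \<le> (1 - t) * ?E x + t * ?E y"
  proof (rule field_le_epsilon)
    fix e :: real assume e: "0 < e"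
    obtain z r where r: "0 \<le> r" "j z = ennreal r" "r + \<Lambda> * \<bar>x - z\<bar> < ?E x + e"
      using lipschitz_envelope_approx[of \<Lambda> j e, OF \<Lambda> j(2) e] by blast
    obtain z' r' where r': "0 \<le> r'" "j z' = ennreal r'" "r' + \<Lambda> * \<bar>y - z'\<bar> < ?E y + e"
      using lipschitz_envelope_approx[of \<Lambda> j e, OF \<Lambda> j(2) e] by blast
    let ?x = "(1 - t) * x + t * y" and ?z = "(1 - t) * z + t * z'"
    have "ennreal (?E ?x) \<le> j ?z + ennreal (\<Lambda> * \<bar>?x - ?z\<bar>)"
      by (rule lipschitz_envelope_le(1)) (use \<Lambda> j in auto)
    also have "j ?z \<le> ennreal (1 - t) * j z + ennreal t * j z'"
      using j(1) t unfolding convex_ennreal_fun_def by auto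
    also have "\<dots> = ennreal ((1 - t) * r + t * r')"
      using r r' t by (simp add: ennreal_mult ennreal_plus)
    finally have "ennreal (?E ?x) \<le> ennreal ((1 - t) * r + t * r') + ennreal (\<Lambda> * \<bar>?x - ?z\<bar>)"
      by (simp add: add_right_mono)
    also have "\<dots> = ennreal ((1 - t) * r + t * r' + \<Lambda> * \<bar>?x - ?z\<bar>)"
      using r r' t \<Lambda> by (simp add: ennreal_plus)
    finally have "?E ?x \<le> (1 - t) * r + t * r' + \<Lambda> * \<bar>?x - ?z\<bar>"
      using r r' t \<Lambda> by (subst (asm) ennreal_le_iff) auto
    also have "\<bar>?x - ?z\<bar> \<le> (1 - t) * \<bar>x - z\<bar> + t * \<bar>y - z'\<bar>"
    proof -
      have "?x - ?z = (1 - t) * (x - z) + t * (y - z')" by (simp add: algebra_simps)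
      then show ?thesis using t abs_triangle_ineq[of "(1 - t) * (x - z)" "t * (y - z')"] by (simp add: abs_mult)
    qed
    finally have "?E ?x \<le> (1 - t) * r + t * r' + \<Lambda> * ((1 - t) * \<bar>x - z\<bar> + t * \<bar>y - z'\<bar>)"
      using \<Lambda> by (auto simp: mult_left_mono)
    also have "\<dots> = (1 - t) * (r + \<Lambda> * \<bar>x - z\<bar>) + t * (r' + \<Lambda> * \<bar>y - z'\<bar>)"
      by (simp add: algebra_simps)
    also have "\<dots> \<le> (1 - t) * (?E x + e) + t * (?E y + e)"
      using less_imp_le[OF r(3)] less_imp_le[OF r'(3)] t
      by (intro add_mono[of "(1 - t) * _"] mult_left_mono) auto
    also have "\<dots> = (1 - t) * ?E x + t * ?E y + e" by (simp add: algebra_simps)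
    finally show "?E ((1 - t) *\<^sub>R x + t *\<^sub>R y) \<le> (1 - t) * ?E x + t * ?E y + e" by simp
  qed
qed simp

text \<open>Lower semicontinuity keeps j above y within some distance \<eta> of x; farther away the
  penalty (n+1)\<eta> alone exceeds y once n is large.\<close>

lemma lipschitz_envelope_eventually_ge:
  assumes j: "lsc_ennreal_fun j" "j 0 = 0" and y: "ennreal y < j x" "0 \<le> y"
  shows "\<forall>\<^sub>F n in sequentially. y \<le> lipschitz_envelope (real (Suc n)) j x"
proof -
  have "\<exists>\<eta>>0. \<forall>z. \<bar>x - z\<bar> < \<eta> \<longrightarrow> ennreal y \<le> j z"
  proof (rule ccontr)
    assume "\<not> ?thesis"
    then have "\<forall>n. \<exists>z. \<bar>x - z\<bar> < 1 / real (Suc n) \<and> j z < ennreal y"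
      by (auto simp: not_le)
    then obtain X where "\<forall>n. \<bar>x - X n\<bar> < 1 / real (Suc n) \<and> j (X n) < ennreal y"
      unfolding choice_iff by blast
    then have X: "\<And>n. \<bar>x - X n\<bar> < 1 / real (Suc n)" "\<And>n. j (X n) < ennreal y" by auto
    have "(\<lambda>n. X n - x) \<longlonglongrightarrow> 0"
    proof (rule Lim_null_comparison)
      show "\<forall>\<^sub>F n in sequentially. norm (X n - x) \<le> 1 / real (Suc n)"
      proof (intro always_eventually allI)
        show "norm (X n - x) \<le> 1 / real (Suc n)" for n
          using less_imp_le[OF X(1)[of n]] by (simp only: real_norm_def abs_minus_commute)
      qed
      show "(\<lambda>n. 1 / real (Suc n)) \<longlonglongrightarrow> 0" by (rule LIMSEQ_Suc[OF lim_1_over_n])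
    qed
    then have "X \<longlonglongrightarrow> x" by (simp add: LIM_zero_iff)
    then have "j x \<le> liminf (\<lambda>n. j (X n))" using j(1) by (auto simp: lsc_ennreal_fun_def)
    also have "\<dots> \<le> liminf (\<lambda>n. ennreal y)"
      using X(2) by (intro Liminf_mono always_eventually) (auto simp: less_imp_le)
    also have "\<dots> = ennreal y" by (simp add: Liminf_const)
    finally show False using y by simp
  qed
  then obtain \<eta> where \<eta>: "0 < \<eta>" "\<And>z. \<bar>x - z\<bar> < \<eta> \<Longrightarrow> ennreal y \<le> j z" by blast
  obtain N where N: "y / \<eta> \<le> real N" using real_arch_simple by blast
  show ?thesis using eventually_ge_at_top[of N]
  proof eventually_elim
    case (elim n)
    have "y / \<eta> \<le> real (Suc n)" using N elim by linarith
    then have n: "y \<le> real (Suc n) * \<eta>" using \<eta>(1) by (simp add: pos_divide_le_eq)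
    have "ennreal y \<le> j z + ennreal (real (Suc n) * \<bar>x - z\<bar>)" for z
    proof (cases "\<bar>x - z\<bar> < \<eta>")
      case True
      then show ?thesis using \<eta>(2) by (meson le_iff_add order_trans)
    next
      case False
      then have "real (Suc n) * \<eta> \<le> real (Suc n) * \<bar>x - z\<bar>" by (intro mult_left_mono) auto
      then have "ennreal y \<le> ennreal (real (Suc n) * \<bar>x - z\<bar>)" using n by (intro ennreal_leI) linarith
      then show ?thesis by (simp add: add_increasing)
    qed
    then have "ennreal y \<le> ennreal (lipschitz_envelope (real (Suc n)) j x)"
      by (subst lipschitz_envelope_le(2)) (auto simp: j intro: INF_greatest)
    then show ?case by (subst (asm) ennreal_le_iff) (auto simp: lipschitz_envelope_nonneg)
  qed
qed

section \<open>Subgradients of convex functions on the line\<close>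

lemma subgradient_exists:
  fixes k :: "real \<Rightarrow> real"
  assumes "convex_on UNIV k"
  shows "\<exists>T. \<forall>a b. k a + T a * (b - a) \<le> k b"
proof (intro exI allI)
  \<comment> \<open>The witness is the right derivative, as the infimum of the slopes to points t >
    a.\<close>
  show "k a + Inf ((\<lambda>t. (k a - k t) / (a - t)) ` ({a<..} \<inter> UNIV)) * (b - a) \<le> k b" for a b
    using convex_le_Inf_differential[OF assms, of a b] by simp
qed

lemma
  fixes k T :: "real \<Rightarrow> real"
  assumes sub: "\<And>a b. k a + T a * (b - a) \<le> k b"
  shows subgradient_mono: "mono T"
    and subgradient_bounded: "(\<And>a. 0 \<le> k a) \<Longrightarrow> (\<And>a. k a \<le> \<Lambda> * \<bar>a\<bar>) \<Longrightarrow> 0 \<le> \<Lambda> \<Longrightarrow> \<bar>T a\<bar> \<le> \<Lambda>"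
    and subgradient_zero: "(\<And>a. \<bar>a\<bar> \<le> \<delta> \<Longrightarrow> k a = 0) \<Longrightarrow> \<bar>a\<bar> < \<delta> \<Longrightarrow> T a = 0"
proof -
  show "mono T"
  proof (rule monoI)
    fix a b :: real assume "a \<le> b"
    have "0 \<le> (T b - T a) * (b - a)"
      using sub[of a b] sub[of b a] by (simp add: algebra_simps)
    with \<open>a \<le> b\<close> show "T a \<le> T b"
      by (cases "a = b") (auto simp: zero_le_mult_iff)
  qed
  show "\<bar>T a\<bar> \<le> \<Lambda>" if k: "\<And>a. 0 \<le> k a" "\<And>a. k a \<le> \<Lambda> * \<bar>a\<bar>" and \<Lambda>: "0 \<le> \<Lambda>"
  proof (rule ccontr)
    assume "\<not> \<bar>T a\<bar> \<le> \<Lambda>"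
    then have pos: "0 < \<bar>T a\<bar> - \<Lambda>" by simp
    \<comment> \<open>Chosen so that (|T a| - \<Lambda>) N = \<Lambda>|a| + 1: after moving a
      distance N in the direction of the slope, the supporting line would lie above the bound
      \<Lambda>(|a| + N) on k.\<close>
    define N where "N = (\<Lambda> * \<bar>a\<bar> + 1) / (\<bar>T a\<bar> - \<Lambda>)"
    have N: "0 < N" using pos \<Lambda> by (auto simp: N_def intro!: divide_pos_pos add_nonneg_pos)
    have "T a * (sgn (T a) * N) \<le> k (a + sgn (T a) * N)"
      using sub[of a "a + sgn (T a) * N"] k(1)[of a] by simp
    also have "\<dots> \<le> \<Lambda> * \<bar>a + sgn (T a) * N\<bar>" by (rule k)
    also have "\<dots> \<le> \<Lambda> * (\<bar>a\<bar> + N)"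
    proof (rule mult_left_mono[OF _ \<Lambda>])
      have "\<bar>sgn (T a) * N\<bar> \<le> N" using N by (auto simp: abs_mult sgn_if)
      then show "\<bar>a + sgn (T a) * N\<bar> \<le> \<bar>a\<bar> + N" using abs_triangle_ineq[of a "sgn (T a) * N"] by linarith
    qed
    finally have "\<bar>T a\<bar> * N \<le> \<Lambda> * (\<bar>a\<bar> + N)" by (simp add: abs_sgn mult.assoc)
    then have "(\<bar>T a\<bar> - \<Lambda>) * N \<le> \<Lambda> * \<bar>a\<bar>" by (simp add: algebra_simps)
    moreover have "(\<bar>T a\<bar> - \<Lambda>) * N = \<Lambda> * \<bar>a\<bar> + 1" using pos by (simp add: N_def)
    ultimately show False by simp
  qed
  show "T a = 0" if "\<And>a. \<bar>a\<bar> \<le> \<delta> \<Longrightarrow> k a = 0" "\<bar>a\<bar> < \<delta>"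
  proof -
    \<comment> \<open>The supporting line at a has value 0 there and stays below k = 0 at \<delta>
      and -\<delta>, which lie on opposite sides of a.\<close>
    have "T a * (\<delta> - a) \<le> 0" "T a * (- \<delta> - a) \<le> 0"
      using sub[of a \<delta>] sub[of a "- \<delta>"] that by auto
    moreover have "0 < \<delta> - a" "- \<delta> - a < 0" using that(2) by auto
    ultimately show ?thesis by (smt (verit) mult_le_0_iff mult_neg_neg)
  qed
qed

text \<open>The approximants are the Lipschitz envelopes of j, lowered by 1/n and cut off at 0 so that
  they vanish near the origin.\<close>

lemma convex_lsc_approximation:
  assumes j: "convex_ennreal_fun j" "lsc_ennreal_fun j" "j 0 = 0"
  obtains k T :: "nat \<Rightarrow> real \<Rightarrow> real" where
    "\<And>n a b. k n a + T n a * (b - a) \<le> k n b" "\<And>n. mono (T n)"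
    "\<And>n s. 0 < s \<Longrightarrow> \<exists>K. \<forall>a. \<bar>T n a\<bar> powr s \<le> K * a\<^sup>2"
    "\<And>n. \<exists>K. \<forall>a. k n a \<le> K * a\<^sup>2" "\<And>n a. 0 \<le> k n a" "\<And>n. k n \<in> borel_measurable borel"
    "\<And>n a. ennreal (k n a) \<le> j a" "\<And>a. j a \<le> liminf (\<lambda>n. ennreal (k n a))"
proof -
  let ?E = "\<lambda>n. lipschitz_envelope (real (Suc n)) j"
  define d where "d n = 1 / real (Suc n)" for n
  \<comment> \<open>The envelope is at most (n+1)|a|, hence at most \<open>d n\<close> for |a| \<le>
    \<open>\<delta> n\<close>; there the lowered and cut-off function is 0.\<close>
  define \<delta> where "\<delta> n = d n / real (Suc n)" for n
  define k where "k n a = max 0 (?E n a - d n)" for n a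
  have d: "0 < d n" "0 < \<delta> n" for n by (auto simp: d_def \<delta>_def)
  have cvx: "convex_on UNIV (k n)" for n
  proof (rule convex_onI)
    fix t x y :: real assume t: "0 < t" "t < 1"
    have E: "?E n ((1 - t) * x + t * y) \<le> (1 - t) * ?E n x + t * ?E n y"
      using convex_onD[OF lipschitz_envelope_convex[of "real (Suc n)" j], of t x y] j t by simp
    have "(1 - t) * (?E n x - d n) \<le> (1 - t) * k n x" "t * (?E n y - d n) \<le> t * k n y"
      using t by (auto simp: k_def intro!: mult_left_mono)
    then have "(1 - t) * ?E n x + t * ?E n y - d n \<le> (1 - t) * k n x + t * k n y"
      by (simp add: algebra_simps)
    moreover have "0 \<le> (1 - t) * k n x + t * k n y" using t by (simp add: k_def)
    ultimately show "k n ((1 - t) *\<^sub>R x + t *\<^sub>R y) \<le> (1 - t) * k n x + t * k n y"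
      using E by (simp add: k_def[of n "(1 - t) * x + t * y"])
  qed simp
  have "\<forall>n. \<exists>T. \<forall>a b. k n a + T a * (b - a) \<le> k n b"
    by (intro allI subgradient_exists cvx)
  then obtain T where "\<forall>n a b. k n a + T n a * (b - a) \<le> k n b"
    unfolding choice_iff by blast
  then have T: "\<And>n a b. k n a + T n a * (b - a) \<le> k n b" by blast
  have k0: "0 \<le> k n a" for n a by (simp add: k_def)
  have kE: "k n a \<le> ?E n a" for n a using d[of n] lipschitz_envelope_nonneg by (auto simp: k_def less_imp_le)
  have k1: "k n a \<le> real (Suc n) * \<bar>a\<bar>" for n a
    using kE[of n a] lipschitz_envelope_le_abs[of "real (Suc n)" j a] j by simp
  have kz: "k n a = 0" if "\<bar>a\<bar> \<le> \<delta> n" for n a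
  proof -
    have "?E n a \<le> real (Suc n) * \<bar>a\<bar>" using lipschitz_envelope_le_abs[of "real (Suc n)" j a] j by simp
    also have "\<dots> \<le> real (Suc n) * \<delta> n" using that by (intro mult_left_mono) auto
    also have "\<dots> = d n" by (simp add: \<delta>_def)
    finally show ?thesis by (simp add: k_def)
  qed
  \<comment> \<open>Outside the interval where the approximant vanishes this factor can be inserted,
    as for truncations, to turn a bound on the subgradient into a quadratic one.\<close>
  have sq: "1 \<le> a\<^sup>2 / (\<delta> n)\<^sup>2" if "\<delta> n \<le> \<bar>a\<bar>" for a n
    using that d[of n] by (simp add: abs_le_square_iff[symmetric])
  show ?thesis
  proof
    show "k n a + T n a * (b - a) \<le> k n b" for n a b by (rule T)
    show "mono (T n)" for n using T by (rule subgradient_mono)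
    show "\<exists>K. \<forall>a. \<bar>T n a\<bar> powr s \<le> K * a\<^sup>2" if s: "0 < s" for n s
    proof (intro exI allI)
      fix a
      show "\<bar>T n a\<bar> powr s \<le> (real (Suc n) powr s / (\<delta> n)\<^sup>2) * a\<^sup>2"
      proof (cases "\<bar>a\<bar> < \<delta> n")
        case True
        then have "T n a = 0" using subgradient_zero[of "k n" "T n" "\<delta> n" a] T kz by blast
        then show ?thesis using s by simp
      next
        case False
        have "\<bar>T n a\<bar> \<le> real (Suc n)"
          using subgradient_bounded[of "k n" "T n" "real (Suc n)" a] T k0 k1 by simp
        then have "\<bar>T n a\<bar> powr s * 1 \<le> real (Suc n) powr s * (a\<^sup>2 / (\<delta> n)\<^sup>2)"
          using False sq[of n a] s by (intro mult_mono powr_mono2) auto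
        then show ?thesis by simp
      qed
    qed
    show "\<exists>K. \<forall>a. k n a \<le> K * a\<^sup>2" for n
    proof (intro exI allI)
      fix a
      show "k n a \<le> (real (Suc n) / \<delta> n) * a\<^sup>2"
      proof (cases "\<bar>a\<bar> < \<delta> n")
        case True
        then show ?thesis using kz[of a n] d[of n] by (simp add: less_imp_le)
      next
        case False
        then have "\<bar>a\<bar> * \<delta> n \<le> \<bar>a\<bar> * \<bar>a\<bar>" by (intro mult_left_mono) auto
        then have "\<bar>a\<bar> \<le> a\<^sup>2 / \<delta> n" using d[of n] by (simp add: pos_le_divide_eq power2_eq_square)
        then have "real (Suc n) * \<bar>a\<bar> \<le> real (Suc n) * (a\<^sup>2 / \<delta> n)" by (intro mult_left_mono) auto
        then show ?thesis using k1[of n a] by simp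
      qed
    qed
    show "0 \<le> k n a" for n a by (rule k0)
    have "continuous_on UNIV (k n)" for n
      using convex_on_continuous[OF _ cvx[of n]] by simp
    then show "k n \<in> borel_measurable borel" for n by (rule borel_measurable_continuous_onI)
    show "ennreal (k n a) \<le> j a" for n a
    proof -
      have "ennreal (k n a) \<le> ennreal (?E n a)" using kE by (rule ennreal_leI)
      also have "\<dots> \<le> j a" using lipschitz_envelope_le(1)[of "real (Suc n)" j a a] j by simp
      finally show ?thesis .
    qed
    show "j a \<le> liminf (\<lambda>n. ennreal (k n a))" for a
      unfolding le_Liminf_iff
    proof (intro allI impI)
      fix y assume y: "y < j a"
      then obtain r where r: "0 \<le> r" "y = ennreal r" by (cases y rule: ennreal_cases) auto
      \<comment> \<open>The intermediate value leaves a gap r' - r that eventually exceeds the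
        lowering \<open>d n\<close>.\<close>
      obtain y' where y': "y < y'" "y' < j a" using y dense by blast
      then obtain r' where r': "0 \<le> r'" "y' = ennreal r'" by (cases y' rule: ennreal_cases) auto
      have less: "r < r'" using y' r r' by (simp add: ennreal_less_iff)
      have "\<forall>\<^sub>F n in sequentially. r' \<le> ?E n a"
        using y' r' j by (intro lipschitz_envelope_eventually_ge) auto
      moreover have "\<forall>\<^sub>F n in sequentially. d n < r' - r"
        using order_tendstoD(2)[OF LIMSEQ_Suc[OF lim_1_over_n], of "r' - r"] less by (simp add: d_def)
      ultimately show "\<forall>\<^sub>F n in sequentially. y < ennreal (k n a)"
      proof eventually_elim
        case (elim n)
        then have "r < k n a" by (simp add: k_def)
        then show ?case using r by (simp add: ennreal_lessI)
      qed
    qed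
  qed
qed

text \<open>Integrating the subgradient inequality k(u + tv) \<ge> k(u) + t v T(u) gives the claim
  for each approximant k, whose integrals are finite by its quadratic bound. Since k \<le> j, the
  right-hand side is bounded by that for j, and Fatou's lemma handles the left-hand side. The powers
  of T are controlled for all s so that one T serves both q and p.\<close>

lemma completely_accretive_criterion:
  assumes u: "u \<in> L2 M" and v: "v \<in> L2 M" and t: "0 < t"
    and j: "convex_ennreal_fun j" "lsc_ennreal_fun j" "j 0 = 0"
    and acc: "\<And>T. mono T \<Longrightarrow> (\<And>s. 0 < s \<Longrightarrow> \<exists>K. \<forall>a. \<bar>T a\<bar> powr s \<le> K * a\<^sup>2)
      \<Longrightarrow> 0 \<le> (\<integral>x. v x * T (u x) \<partial>M)"
  shows "(\<integral>\<^sup>+x. j (u x) \<partial>M) \<le> (\<integral>\<^sup>+x. j (u x + t * v x) \<partial>M)"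
proof -
  obtain k T :: "nat \<Rightarrow> real \<Rightarrow> real" where sub: "\<And>n a b. k n a + T n a * (b - a) \<le> k n b" and mono: "\<And>n. mono (T n)"
    and T_le: "\<And>n s. 0 < s \<Longrightarrow> \<exists>K. \<forall>a. \<bar>T n a\<bar> powr s \<le> K * a\<^sup>2"
    and k_le: "\<And>n. \<exists>K. \<forall>a. k n a \<le> K * a\<^sup>2" and k_nonneg: "\<And>n a. 0 \<le> k n a"
    and [measurable]: "\<And>n. k n \<in> borel_measurable borel"
    and k_j: "\<And>n a. ennreal (k n a) \<le> j a" and j_lim: "\<And>a. j a \<le> liminf (\<lambda>n. ennreal (k n a))"
    by (rule convex_lsc_approximation[OF j]) blast
  have [measurable]: "u \<in> borel_measurable M" "v \<in> borel_measurable M" using u v by (auto simp: L2_def)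
  have [measurable]: "T n \<in> borel_measurable borel" for n using mono by (rule borel_measurable_mono)
  have ik: "integrable M (\<lambda>x. k n (w x))" if w: "w \<in> L2 M" for n w
  proof -
    obtain K where K: "\<And>a. k n a \<le> K * a\<^sup>2" using k_le by blast
    have [measurable]: "w \<in> borel_measurable M" using w by (auto simp: L2_def)
    show ?thesis
    proof (rule Bochner_Integration.integrable_bound)
      show "integrable M (\<lambda>x. K * (w x)\<^sup>2)" using w by (auto simp: L2_def)
      show "AE x in M. norm (k n (w x)) \<le> norm (K * (w x)\<^sup>2)"
        using k_nonneg by (auto intro!: AE_I2 order_trans[OF K abs_ge_self])
    qed measurable
  qed
  have step: "(\<integral>\<^sup>+x. ennreal (k n (u x)) \<partial>M) \<le> (\<integral>\<^sup>+x. j (u x + t * v x) \<partial>M)" for n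
  proof -
    obtain K where K: "\<And>a. \<bar>T n a\<bar> powr 2 \<le> K * a\<^sup>2" using T_le[of 2] by auto
    have "(\<lambda>x. T n (u x)) \<in> L2 M"
    proof (rule L2_dominated)
      show "integrable M (\<lambda>x. K * (u x)\<^sup>2)" using u by (auto simp: L2_def)
      show "AE x in M. (T n (u x))\<^sup>2 \<le> K * (u x)\<^sup>2" using K by simp
    qed measurable
    then have iT: "integrable M (\<lambda>x. v x * T n (u x))" by (intro L2_mult_integrable v)
    have iv: "integrable M (\<lambda>x. k n (u x + t * v x))" by (intro ik L2_add L2_cmult u v)
    have "0 \<le> (\<integral>x. v x * T n (u x) \<partial>M)" by (intro acc mono T_le)
    then have "(\<integral>x. k n (u x) \<partial>M) \<le> (\<integral>x. k n (u x) + t * (v x * T n (u x)) \<partial>M)"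
      using t ik[OF u, of n] iT by simp
    also have "\<dots> \<le> (\<integral>x. k n (u x + t * v x) \<partial>M)"
    proof (rule integral_mono)
      show "k n (u x) + t * (v x * T n (u x)) \<le> k n (u x + t * v x)" for x
        using sub[of n "u x" "u x + t * v x"] by (simp add: mult_ac)
    qed (use ik[OF u, of n] iT iv in auto)
    finally have "(\<integral>\<^sup>+x. ennreal (k n (u x)) \<partial>M) \<le> (\<integral>\<^sup>+x. ennreal (k n (u x + t * v x)) \<partial>M)"
      using ik[OF u, of n] iv k_nonneg by (simp add: nn_integral_eq_integral ennreal_leI)
    also have "\<dots> \<le> (\<integral>\<^sup>+x. j (u x + t * v x) \<partial>M)" by (intro nn_integral_mono k_j)
    finally show ?thesis .
  qed
  have "(\<integral>\<^sup>+x. j (u x) \<partial>M) \<le> (\<integral>\<^sup>+x. liminf (\<lambda>n. ennreal (k n (u x))) \<partial>M)"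
    by (intro nn_integral_mono j_lim)
  also have "\<dots> \<le> liminf (\<lambda>n. \<integral>\<^sup>+x. ennreal (k n (u x)) \<partial>M)"
    by (intro nn_integral_liminf) auto
  also have "\<dots> \<le> liminf (\<lambda>n. \<integral>\<^sup>+x. j (u x + t * v x) \<partial>M)"
    by (intro Liminf_mono always_eventually allI step)
  also have "\<dots> = (\<integral>\<^sup>+x. j (u x + t * v x) \<partial>M)" by (simp add: Liminf_const)
  finally show ?thesis .
qed

section \<open>The sum of two energies\<close>

text \<open>Split according to the size of a: where it is large the exponent r >= 2 helps; where it is
  small, either b or d is comparable to it and the exponent r' <= 2 helps.\<close>

lemma square_le_mixed_powers:
  fixes a b d C r r' :: real
  assumes "\<bar>a\<bar> \<le> \<bar>b\<bar> + C * \<bar>d\<bar>" "0 < C" "2 \<le> r" "0 < r'" "r' \<le> 2"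
  shows "a\<^sup>2 \<le> 4 * b\<^sup>2 + \<bar>a\<bar> powr r + (2 * C) powr r' * \<bar>d\<bar> powr r'"
proof -
  have sq: "x\<^sup>2 = \<bar>x\<bar> powr 2" for x :: real by simp
  \<comment> \<open>If |a| > 2|b|, the hypothesis leaves |a|/2 < C|d|, which is the bound of the
    third case.\<close>
  consider "1 < \<bar>a\<bar>" | "\<bar>a\<bar> \<le> 2 * \<bar>b\<bar>" | "\<bar>a\<bar> \<le> 1" "\<bar>a\<bar> \<le> 2 * C * \<bar>d\<bar>" using assms by linarith
  then show ?thesis
  proof cases
    case 1
    then have "a\<^sup>2 \<le> \<bar>a\<bar> powr r" unfolding sq using assms by (intro powr_mono) auto
    then show ?thesis by (smt (verit) mult_nonneg_nonneg powr_ge_zero zero_le_power2)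
  next
    case 2
    then have "\<bar>a\<bar>\<^sup>2 \<le> (2 * \<bar>b\<bar>)\<^sup>2" by (intro power_mono) auto
    then have "a\<^sup>2 \<le> 4 * b\<^sup>2" by (simp add: power_mult_distrib)
    then show ?thesis by (smt (verit) mult_nonneg_nonneg powr_ge_zero zero_le_power2)
  next
    case 3
    have "a\<^sup>2 \<le> \<bar>a\<bar> powr r'" unfolding sq using 3 assms by (intro powr_mono') auto
    also have "\<dots> \<le> (2 * C * \<bar>d\<bar>) powr r'" using 3 assms by (intro powr_mono2) auto
    also have "\<dots> = (2 * C) powr r' * \<bar>d\<bar> powr r'" using assms by (simp add: powr_mult)
    finally show ?thesis by (smt (verit) mult_nonneg_nonneg powr_ge_zero zero_le_power2)
  qed
qed

locale two_walks = W1: reversible_walk m1 \<nu>1 + W2: reversible_walk m2 \<nu>2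
  for m1 m2 :: "'a \<Rightarrow> 'a measure" and \<nu>1 \<nu>2 :: "'a measure" +
  fixes \<mu> :: "'a \<Rightarrow> real" and c C :: real
  assumes sets_eq [measurable_cong]: "sets \<nu>2 = sets \<nu>1"
    and \<mu>_measurable [measurable]: "\<mu> \<in> borel_measurable \<nu>1"
    and \<nu>2_eq: "\<nu>2 = density \<nu>1 (\<lambda>x. ennreal (\<mu> x))"
    and \<mu>_le: "AE x in \<nu>1. \<bar>\<mu> x\<bar> \<le> C" and c_pos: "0 < c" and \<mu>_ge: "AE x in \<nu>1. c \<le> \<mu> x"
begin

section \<open>Change between the two invariant measures\<close>

lemma measurable_\<nu>2: "f \<in> borel_measurable \<nu>2 \<longleftrightarrow> f \<in> borel_measurable \<nu>1"
  by (simp only: measurable_cong_sets[OF sets_eq refl])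

lemma \<mu>_nonneg: "AE x in \<nu>1. 0 \<le> \<mu> x"
  using \<mu>_ge c_pos by auto

lemma integral_\<nu>2:
  fixes g :: "'a \<Rightarrow> real"
  assumes [measurable]: "g \<in> borel_measurable \<nu>1"
  shows "(\<integral>x. g x \<partial>\<nu>2) = (\<integral>x. \<mu> x * g x \<partial>\<nu>1)"
  unfolding \<nu>2_eq using \<mu>_nonneg by (subst integral_density) auto

lemma integrable_\<nu>2_iff_mult:
  fixes g :: "'a \<Rightarrow> real"
  assumes [measurable]: "g \<in> borel_measurable \<nu>1"
  shows "integrable \<nu>2 g \<longleftrightarrow> integrable \<nu>1 (\<lambda>x. \<mu> x * g x)"
  unfolding \<nu>2_eq using \<mu>_nonneg by (subst integrable_density) auto

text \<open>The density lies between the positive constants c and C almost everywhere (unless \<nu>1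
  is null), so integrability, and with it L2, is the same for both measures.\<close>

lemma integrable_\<nu>2_iff:
  fixes g :: "'a \<Rightarrow> real"
  assumes [measurable]: "g \<in> borel_measurable \<nu>1"
  shows "integrable \<nu>2 g \<longleftrightarrow> integrable \<nu>1 g"
  unfolding integrable_\<nu>2_iff_mult[OF assms]
proof
  assume i: "integrable \<nu>1 (\<lambda>x. \<mu> x * g x)"
  show "integrable \<nu>1 g"
  proof (rule Bochner_Integration.integrable_bound)
    show "integrable \<nu>1 (\<lambda>x. (1 / c) * (\<mu> x * g x))" using i by simp
    show "AE x in \<nu>1. norm (g x) \<le> norm ((1 / c) * (\<mu> x * g x))"
      using \<mu>_ge
    proof eventually_elim
      case (elim x)
      then have "c * \<bar>g x\<bar> \<le> \<mu> x * \<bar>g x\<bar>" by (intro mult_right_mono) auto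
      then show ?case using c_pos elim by (simp add: abs_mult field_simps)
    qed
  qed measurable
next
  assume i: "integrable \<nu>1 g"
  show "integrable \<nu>1 (\<lambda>x. \<mu> x * g x)"
  proof (rule Bochner_Integration.integrable_bound)
    show "integrable \<nu>1 (\<lambda>x. C * g x)" using i by simp
    show "AE x in \<nu>1. norm (\<mu> x * g x) \<le> norm (C * g x)"
      using \<mu>_le by eventually_elim (auto simp: abs_mult intro!: mult_right_mono)
  qed measurable
qed

lemma L2_\<nu>2: "L2 \<nu>2 = L2 \<nu>1"
  unfolding L2_def using integrable_\<nu>2_iff[of "\<lambda>x. (u x)\<^sup>2" for u] by (auto simp: measurable_\<nu>2)

lemma L2_\<mu>_mult:
  assumes "w \<in> L2 \<nu>1" shows "(\<lambda>x. \<mu> x * w x) \<in> L2 \<nu>1"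
proof (rule L2_dominated)
  show "integrable \<nu>1 (\<lambda>x. C\<^sup>2 * (w x)\<^sup>2)" using L2_D(2)[OF assms] by simp
  show "AE x in \<nu>1. (\<mu> x * w x)\<^sup>2 \<le> C\<^sup>2 * (w x)\<^sup>2"
    using \<mu>_le by eventually_elim
      (auto simp: power_mult_distrib intro!: mult_right_mono intro: power2_le_iff_abs_le[THEN iffD2])
qed (use L2_D(1)[OF assms] in measurable)

section \<open>The operator and the subdifferential\<close>

definition total_energy :: "real \<Rightarrow> real \<Rightarrow> ('a \<Rightarrow> real) \<Rightarrow> ereal" where
  "total_energy q p u = energy m1 \<nu>1 q u + energy m2 \<nu>2 p u"

text \<open>The two subgradient inequalities add up; the pairing of w2 under \<nu>2 is that of \<mu>
  w2 under \<nu>1.\<close>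

lemma sum_operator_subset_subdiff:
  assumes q: "1 < q" and p: "1 < p"
  shows "sum_operator m1 \<nu>1 q m2 \<nu>2 p \<mu> \<subseteq> subdiff \<nu>1 (total_energy q p)"
proof clarify
  fix u v assume "(u, v) \<in> sum_operator m1 \<nu>1 q m2 \<nu>2 p \<mu>"
  then obtain w1 w2 where u: "u \<in> L2 \<nu>1" "v \<in> L2 \<nu>1"
    and w: "(u, w1) \<in> p_laplacian m1 \<nu>1 q" "(u, w2) \<in> p_laplacian m2 \<nu>2 p"
    and v: "AE x in \<nu>1. v x = - w1 x - \<mu> x * w2 x"
    by (auto simp: sum_operator_def)
  have w1: "w1 \<in> L2 \<nu>1" and w2: "w2 \<in> L2 \<nu>1" using w by (auto simp: p_laplacian_def L2_\<nu>2)
  have fin: "energy m1 \<nu>1 q u < \<infinity>" "energy m2 \<nu>2 p u < \<infinity>"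
    using w p q W1.energy_finite_iff[of q u] W2.energy_finite_iff[of p u]
    by (auto simp: p_laplacian_def)
  show "(u, v) \<in> subdiff \<nu>1 (total_energy q p)"
    unfolding subdiff_def
  proof (clarify, intro conjI ballI)
    show "u \<in> L2 \<nu>1" "v \<in> L2 \<nu>1" by fact+
    show "total_energy q p u < \<infinity>" using fin by (simp add: total_energy_def)
    fix w assume wL: "w \<in> L2 \<nu>1"
    have [measurable]: "u \<in> borel_measurable \<nu>1" "v \<in> borel_measurable \<nu>1" "w \<in> borel_measurable \<nu>1"
        "w1 \<in> borel_measurable \<nu>1" "w2 \<in> borel_measurable \<nu>1"
      using wL u w1 w2 by (auto simp: L2_def)
    let ?\<phi> = "\<lambda>x. w x - u x"
    have \<phi>: "?\<phi> \<in> L2 \<nu>1" by (intro L2_diff wL u)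
    have "(\<integral>x. v x * ?\<phi> x \<partial>\<nu>1) = (\<integral>x. - (w1 x * ?\<phi> x) - \<mu> x * w2 x * ?\<phi> x \<partial>\<nu>1)"
    proof (rule integral_cong_AE)
      show "AE x in \<nu>1. v x * ?\<phi> x = - (w1 x * ?\<phi> x) - \<mu> x * w2 x * ?\<phi> x"
        using v
      proof eventually_elim
        case (elim x)
        show ?case unfolding elim by (simp add: algebra_simps)
      qed
    qed measurable
    also have "\<dots> = - (\<integral>x. w1 x * ?\<phi> x \<partial>\<nu>1) - (\<integral>x. \<mu> x * w2 x * ?\<phi> x \<partial>\<nu>1)"
      using L2_mult_integrable[OF w1 \<phi>] L2_mult_integrable[OF L2_\<mu>_mult[OF w2] \<phi>] by simp
    also have "(\<integral>x. \<mu> x * w2 x * ?\<phi> x \<partial>\<nu>1) = (\<integral>x. w2 x * ?\<phi> x \<partial>\<nu>2)"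
      by (subst integral_\<nu>2) (auto simp: mult.assoc)
    finally have "ereal (\<integral>x. v x * ?\<phi> x \<partial>\<nu>1) =
        ereal (- (\<integral>x. w1 x * ?\<phi> x \<partial>\<nu>1)) + ereal (- (\<integral>x. w2 x * ?\<phi> x \<partial>\<nu>2))" by simp
    then have "total_energy q p u + ereal (\<integral>x. v x * ?\<phi> x \<partial>\<nu>1) =
       (energy m1 \<nu>1 q u + ereal (- (\<integral>x. w1 x * ?\<phi> x \<partial>\<nu>1))) +
       (energy m2 \<nu>2 p u + ereal (- (\<integral>x. w2 x * ?\<phi> x \<partial>\<nu>2)))"
      by (simp only: total_energy_def add_ac)
    also have "\<dots> \<le> total_energy q p w"
      unfolding total_energy_def using w wL q p
      by (intro add_mono W1.energy_ge_of_p_laplacian W2.energy_ge_of_p_laplacian) (auto simp: L2_\<nu>2)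
    finally show "total_energy q p u + ereal (\<integral>x. v x * ?\<phi> x \<partial>\<nu>1) \<le> total_energy q p w" .
  qed
qed

text \<open>One-sided variations suffice because the test function carries the sign of the residual
  h: minimality makes the integral of h \<phi> nonpositive, while the integrand is |h| on the
  support of \<phi>.\<close>

lemma subdiff_euler_lagrange:
  assumes q: "1 < q" and p: "1 < p" and uv: "(u, v) \<in> subdiff \<nu>1 (total_energy q p)"
  shows "grad_energy m1 \<nu>1 q u < \<infinity>" "grad_energy m2 \<nu>2 p u < \<infinity>"
    and "AE x in \<nu>1. v x = - W1.laplace q u x - \<mu> x * W2.laplace p u x"
proof -
  have uL: "u \<in> L2 \<nu>1" and vL: "v \<in> L2 \<nu>1" and fin: "total_energy q p u < \<infinity>"
    and min: "\<And>w. w \<in> L2 \<nu>1 \<Longrightarrow> total_energy q p u + ereal (\<integral>x. v x * (w x - u x) \<partial>\<nu>1) \<le> total_energy q p w"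
    using uv by (auto simp: subdiff_def)
  \<comment> \<open>Nonnegativity excludes cancellation, so finiteness of the sum passes to each
    energy.\<close>
  have nn: "0 \<le> energy m1 \<nu>1 q u" "0 \<le> energy m2 \<nu>2 p u"
    using p q by (auto intro: W1.energy_nonneg W2.energy_nonneg)
  have efin: "energy m1 \<nu>1 q u < \<infinity>" "energy m2 \<nu>2 p u < \<infinity>"
    using fin nn by (auto simp: total_energy_def)
  then show g: "grad_energy m1 \<nu>1 q u < \<infinity>" "grad_energy m2 \<nu>2 p u < \<infinity>"
    using W1.energy_finite_iff[of q u] W2.energy_finite_iff[of p u] p q by auto
  obtain e1 e2 where e: "energy m1 \<nu>1 q u = ereal e1" "energy m2 \<nu>2 p u = ereal e2"
    using efin nn by (cases "energy m1 \<nu>1 q u"; cases "energy m2 \<nu>2 p u") auto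
  have [measurable]: "u \<in> borel_measurable \<nu>1" "v \<in> borel_measurable \<nu>1" using uL vL by (auto simp: L2_def)
  have u2[measurable]: "u \<in> borel_measurable \<nu>2" by measurable
  have [measurable]: "W2.laplace p u \<in> borel_measurable \<nu>1"
    using W2.laplace_measurable[OF u2, of p] by (simp add: measurable_\<nu>2)
  have iu: "integrable W1.pairs (\<lambda>z. \<bar>grad u z\<bar> powr q)" "integrable W2.pairs (\<lambda>z. \<bar>grad u z\<bar> powr p)"
    using g W1.grad_energy_finite_iff[of u q] W2.grad_energy_finite_iff[OF u2, of p] by auto
  define h where "h x = v x + W1.laplace q u x + \<mu> x * W2.laplace p u x" for x
  have [measurable]: "h \<in> borel_measurable \<nu>1" unfolding h_def by measurable
  have AE_B: "AE x in \<nu>1. x \<in> B \<longrightarrow> h x = 0" if [measurable]: "B \<in> sets \<nu>1" and B: "emeasure \<nu>1 B \<noteq> \<infinity>" for B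
  proof -
    \<comment> \<open>Bounded and supported in a set of finite measure, hence in every L^s for both
      measures: both Laplacians pair with it although neither is yet known to be in L2.\<close>
    define \<phi> where "\<phi> x = indicator B x * sgn (h x)" for x
    have [measurable]: "\<phi> \<in> borel_measurable \<nu>1" unfolding \<phi>_def by measurable
    have \<phi>2[measurable]: "\<phi> \<in> borel_measurable \<nu>2" by measurable
    have iB: "integrable \<nu>1 (indicator B :: _ \<Rightarrow> real)" using B by (simp add: integrable_indicator_iff less_top)
    have i\<phi>: "integrable \<nu>1 (\<lambda>x. \<bar>\<phi> x\<bar> powr s)" for s
      by (rule Bochner_Integration.integrable_bound[OF iB])
         (auto simp: \<phi>_def indicator_def sgn_if intro!: AE_I2)
    then have i\<phi>2: "integrable \<nu>2 (\<lambda>x. \<bar>\<phi> x\<bar> powr s)" for s by (simp add: integrable_\<nu>2_iff)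
    have \<phi>L: "\<phi> \<in> L2 \<nu>1" using i\<phi>[of 2] by (simp add: L2_def)
    obtain R1 where R1: "\<And>n. energy m1 \<nu>1 q (\<lambda>x. u x + \<phi> x / real (Suc n)) \<le> energy m1 \<nu>1 q u + ereal (R1 n / real (Suc n))"
       "R1 \<longlonglongrightarrow> - (\<integral>x. W1.laplace q u x * \<phi> x \<partial>\<nu>1)"
      using W1.energy_directional[OF _ _ q iu(1) i\<phi>] by auto
    obtain R2 where R2: "\<And>n. energy m2 \<nu>2 p (\<lambda>x. u x + \<phi> x / real (Suc n)) \<le> energy m2 \<nu>2 p u + ereal (R2 n / real (Suc n))"
       "R2 \<longlonglongrightarrow> - (\<integral>x. W2.laplace p u x * \<phi> x \<partial>\<nu>2)"
      using W2.energy_directional[OF u2 \<phi>2 p iu(2) i\<phi>2] by auto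
    \<comment> \<open>The real energies e1 and e2 cancel and the common factor 1/(n+1) drops out,
      leaving a first-order inequality ready for the limit.\<close>
    have "(\<integral>x. v x * \<phi> x \<partial>\<nu>1) \<le> R1 n + R2 n" for n
    proof -
      let ?w = "\<lambda>x. u x + \<phi> x / real (Suc n)"
      have "?w \<in> L2 \<nu>1" using L2_add[OF uL L2_cmult[OF \<phi>L, of "1 / real (Suc n)"]] by simp
      from min[OF this] have "total_energy q p u + ereal ((\<integral>x. v x * \<phi> x \<partial>\<nu>1) / real (Suc n)) \<le> total_energy q p ?w"
        by simp
      also have "\<dots> \<le> (ereal e1 + ereal (R1 n / real (Suc n))) + (ereal e2 + ereal (R2 n / real (Suc n)))"
        unfolding total_energy_def e[symmetric] by (intro add_mono R1 R2)
      finally have "(\<integral>x. v x * \<phi> x \<partial>\<nu>1) / real (Suc n) \<le> (R1 n + R2 n) / real (Suc n)"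
        by (simp add: total_energy_def e add_divide_distrib)
      then show ?thesis by (simp add: divide_le_cancel del: of_nat_Suc)
    qed
    then have "(\<integral>x. v x * \<phi> x \<partial>\<nu>1) \<le> - (\<integral>x. W1.laplace q u x * \<phi> x \<partial>\<nu>1) + - (\<integral>x. W2.laplace p u x * \<phi> x \<partial>\<nu>2)"
      by (intro LIMSEQ_le_const[OF tendsto_add[OF R1(2) R2(2)]]) auto
    moreover have "(\<integral>x. W2.laplace p u x * \<phi> x \<partial>\<nu>2) = (\<integral>x. \<mu> x * (W2.laplace p u x * \<phi> x) \<partial>\<nu>1)"
      by (rule integral_\<nu>2) measurable
    moreover have i1: "integrable \<nu>1 (\<lambda>x. v x * \<phi> x)" by (rule L2_mult_integrable[OF vL \<phi>L])
    moreover have i2: "integrable \<nu>1 (\<lambda>x. W1.laplace q u x * \<phi> x)"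
      by (rule W1.integrable_laplace_mult[OF _ _ q iu(1) i\<phi>]) measurable
    moreover have i3: "integrable \<nu>1 (\<lambda>x. \<mu> x * (W2.laplace p u x * \<phi> x))"
      using W2.integrable_laplace_mult[OF u2 \<phi>2 p iu(2) i\<phi>2] by (subst integrable_\<nu>2_iff_mult[symmetric]) auto
    moreover have h\<phi>: "h x * \<phi> x = v x * \<phi> x + W1.laplace q u x * \<phi> x + \<mu> x * (W2.laplace p u x * \<phi> x)" for x
      by (simp add: h_def algebra_simps)
    ultimately have "(\<integral>x. h x * \<phi> x \<partial>\<nu>1) \<le> 0" by simp
    moreover have nonneg: "0 \<le> h x * \<phi> x" for x by (auto simp: \<phi>_def indicator_def sgn_if)
    then have "0 \<le> (\<integral>x. h x * \<phi> x \<partial>\<nu>1)" by (intro integral_nonneg_AE) auto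
    ultimately have "(\<integral>x. h x * \<phi> x \<partial>\<nu>1) = 0" by simp
    moreover have "integrable \<nu>1 (\<lambda>x. h x * \<phi> x)" unfolding h\<phi> using i1 i2 i3 by simp
    ultimately have "AE x in \<nu>1. h x * \<phi> x = 0"
      using nonneg by (subst (asm) integral_nonneg_eq_0_iff_AE) auto
    then show ?thesis by eventually_elim (auto simp: \<phi>_def sgn_if indicator_def split: if_splits)
  qed
  obtain A :: "nat \<Rightarrow> 'a set" where A: "range A \<subseteq> sets \<nu>1" "(\<Union>i. A i) = space \<nu>1" "\<And>i. emeasure \<nu>1 (A i) \<noteq> \<infinity>"
    using W1.sigma_finite by metis
  have "AE x in \<nu>1. \<forall>i. x \<in> A i \<longrightarrow> h x = 0"
    using A by (subst AE_all_countable) (auto intro: AE_B)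
  then show "AE x in \<nu>1. v x = - W1.laplace q u x - \<mu> x * W2.laplace p u x"
    using AE_space by eventually_elim (use A(2) in \<open>auto simp: h_def\<close>)
qed

lemma subdiff_subset_sum_operator:
  assumes q: "1 < q" "q \<le> 2" and p: "1 < p"
    and cases: "emeasure \<nu>1 (space \<nu>1) < \<infinity> \<or> 2 \<le> p"
  shows "subdiff \<nu>1 (total_energy q p) \<subseteq> sum_operator m1 \<nu>1 q m2 \<nu>2 p \<mu>"
proof clarify
  fix u v assume uv: "(u, v) \<in> subdiff \<nu>1 (total_energy q p)"
  note el = subdiff_euler_lagrange[OF q(1) p uv]
  let ?l1 = "W1.laplace q u" and ?l2 = "W2.laplace p u"
  have uL: "u \<in> L2 \<nu>1" and vL: "v \<in> L2 \<nu>1" using uv by (auto simp: subdiff_def)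
  have [measurable]: "u \<in> borel_measurable \<nu>1" "v \<in> borel_measurable \<nu>1" using uL vL by (auto simp: L2_def)
  have u2[measurable]: "u \<in> borel_measurable \<nu>2" by measurable
  have [measurable]: "?l2 \<in> borel_measurable \<nu>1"
    using W2.laplace_measurable[OF u2, of p] by (simp add: measurable_\<nu>2)
  have iu: "integrable W1.pairs (\<lambda>z. \<bar>grad u z\<bar> powr q)" "integrable W2.pairs (\<lambda>z. \<bar>grad u z\<bar> powr p)"
    using el(1,2) W1.grad_energy_finite_iff[of u q] W2.grad_energy_finite_iff[OF u2, of p] by auto
  have l1: "integrable \<nu>1 (\<lambda>x. \<bar>?l1 x\<bar> powr (q / (q - 1)))"
    using q iu(1) by (intro W1.integrable_laplace_powr) auto
  have "integrable \<nu>2 (\<lambda>x. \<bar>?l2 x\<bar> powr (p / (p - 1)))"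
    using p iu(2) by (intro W2.integrable_laplace_powr) auto
  then have l2: "integrable \<nu>1 (\<lambda>x. \<bar>?l2 x\<bar> powr (p / (p - 1)))"
    by (simp add: integrable_\<nu>2_iff)
  have q': "2 \<le> q / (q - 1)" using q by (simp add: field_simps)
  have l1L: "?l1 \<in> L2 \<nu>1"
    using cases
  proof
    assume fin: "emeasure \<nu>1 (space \<nu>1) < \<infinity>"
    then have "integrable \<nu>1 (\<lambda>_. 1 :: real)"
      using finite_measureI[of \<nu>1] finite_measure.integrable_const by (metis infinity_ennreal_def less_irrefl)
    \<comment> \<open>The constant, integrable because the measure is finite, covers the region |a|
      \<le> 1; beyond it the exponent q/(q-1) \<ge> 2 dominates the square.\<close>
    then have i: "integrable \<nu>1 (\<lambda>x. 1 + \<bar>?l1 x\<bar> powr (q / (q - 1)))" using l1 by simp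
    have "a\<^sup>2 \<le> 1 + \<bar>a\<bar> powr (q / (q - 1))" for a :: real
    proof (cases "\<bar>a\<bar> \<le> 1")
      case True
      then have "a\<^sup>2 \<le> 1" by (simp add: abs_square_le_1)
      then show ?thesis by (smt (verit) powr_ge_zero)
    next
      case False
      then have "\<bar>a\<bar> powr 2 \<le> \<bar>a\<bar> powr (q / (q - 1))" using q' by (intro powr_mono) auto
      then show ?thesis by simp
    qed
    then show ?thesis by (intro L2_dominated[OF _ i]) auto
  next
    assume p2: "2 \<le> p"
    \<comment> \<open>\<open>square_le_mixed_powers\<close> wants a positive constant, and C need
      not be positive when \<nu>1 is null.\<close>
    define D where "D = max 1 C"
    have D: "0 < D" by (simp add: D_def)
    show ?thesis
    proof (rule L2_dominated)
      show "integrable \<nu>1 (\<lambda>x. 4 * (v x)\<^sup>2 + \<bar>?l1 x\<bar> powr (q / (q - 1)) + (2 * D) powr (p / (p - 1)) * \<bar>?l2 x\<bar> powr (p / (p - 1)))"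
        using l1 l2 L2_D(2)[OF vL] by simp
      show "AE x in \<nu>1. (?l1 x)\<^sup>2 \<le> 4 * (v x)\<^sup>2 + \<bar>?l1 x\<bar> powr (q / (q - 1)) + (2 * D) powr (p / (p - 1)) * \<bar>?l2 x\<bar> powr (p / (p - 1))"
        using el(3) \<mu>_le
      proof eventually_elim
        case (elim x)
        have "?l1 x = - v x - \<mu> x * ?l2 x" using elim by simp
        then have "\<bar>?l1 x\<bar> \<le> \<bar>v x\<bar> + \<bar>\<mu> x\<bar> * \<bar>?l2 x\<bar>" unfolding abs_mult[symmetric] by linarith
        also have "\<bar>\<mu> x\<bar> * \<bar>?l2 x\<bar> \<le> D * \<bar>?l2 x\<bar>"
          using elim by (intro mult_right_mono) (auto simp: D_def)
        finally have "\<bar>?l1 x\<bar> \<le> \<bar>v x\<bar> + D * \<bar>?l2 x\<bar>" by simp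
        then show ?case using D q' p p2 by (intro square_le_mixed_powers) (auto simp: field_simps)
      qed
    qed measurable
  qed
  \<comment> \<open>The conjugate exponent of p may lie below 2, so Jensen alone does not give this.
    Once \<open>?l1\<close> is in L2, the equation \<mu> \<open>?l2\<close> = -(v +
    \<open>?l1\<close>) can be divided by \<mu> \<ge> c.\<close>
  have l2L: "?l2 \<in> L2 \<nu>1"
  proof (rule L2_dominated)
    have "(\<lambda>x. v x + ?l1 x) \<in> L2 \<nu>1" by (intro L2_add vL l1L)
    then show "integrable \<nu>1 (\<lambda>x. (1 / c\<^sup>2) * (v x + ?l1 x)\<^sup>2)" by (auto simp: L2_def)
    show "AE x in \<nu>1. (?l2 x)\<^sup>2 \<le> (1 / c\<^sup>2) * (v x + ?l1 x)\<^sup>2"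
      using el(3) \<mu>_ge
    proof eventually_elim
      case (elim x)
      have "v x + ?l1 x = - (\<mu> x * ?l2 x)" using elim by simp
      then have "(v x + ?l1 x)\<^sup>2 = (\<mu> x)\<^sup>2 * (?l2 x)\<^sup>2" by (simp add: power_mult_distrib)
      moreover have "c\<^sup>2 * (?l2 x)\<^sup>2 \<le> (\<mu> x)\<^sup>2 * (?l2 x)\<^sup>2"
        using elim c_pos by (intro mult_right_mono power_mono) auto
      ultimately show ?case using c_pos by (simp add: field_simps)
    qed
  qed measurable
  have "(u, ?l1) \<in> p_laplacian m1 \<nu>1 q" "(u, ?l2) \<in> p_laplacian m2 \<nu>2 p"
    using iu uL l1L l2L by (auto simp: W1.p_laplacian_iff W2.p_laplacian_iff L2_\<nu>2)
  then show "(u, v) \<in> sum_operator m1 \<nu>1 q m2 \<nu>2 p \<mu>"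
    using el(3) uL vL by (auto simp: sum_operator_def)
qed

text \<open>The same T is tested in both Laplacians: the weight \<mu> turns the second term into an
  integral over \<nu>2, so each term has a sign on its own.\<close>

lemma sum_operator_completely_accretive:
  assumes q: "1 < q" and p: "1 < p"
  shows "completely_accretive \<nu>1 (sum_operator m1 \<nu>1 q m2 \<nu>2 p \<mu>)"
proof -
  have "(\<integral>\<^sup>+ x. j (u x - u' x) \<partial>\<nu>1) \<le> (\<integral>\<^sup>+ x. j (u x - u' x + t * (v x - v' x)) \<partial>\<nu>1)"
    if t: "0 < t" and uv: "(u, v) \<in> sum_operator m1 \<nu>1 q m2 \<nu>2 p \<mu>"
      and uv': "(u', v') \<in> sum_operator m1 \<nu>1 q m2 \<nu>2 p \<mu>"
      and j: "convex_ennreal_fun j" "lsc_ennreal_fun j" "j 0 = 0" for t u v u' v' j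
  proof -
    obtain w1 w2 where w: "(u, w1) \<in> p_laplacian m1 \<nu>1 q" "(u, w2) \<in> p_laplacian m2 \<nu>2 p"
      "AE x in \<nu>1. v x = - w1 x - \<mu> x * w2 x" and L: "u \<in> L2 \<nu>1" "v \<in> L2 \<nu>1"
      using uv by (auto simp: sum_operator_def)
    obtain w1' w2' where w': "(u', w1') \<in> p_laplacian m1 \<nu>1 q" "(u', w2') \<in> p_laplacian m2 \<nu>2 p"
      "AE x in \<nu>1. v' x = - w1' x - \<mu> x * w2' x" and L': "u' \<in> L2 \<nu>1" "v' \<in> L2 \<nu>1"
      using uv' by (auto simp: sum_operator_def)
    have wL: "w1 \<in> L2 \<nu>1" "w2 \<in> L2 \<nu>1" "w1' \<in> L2 \<nu>1" "w2' \<in> L2 \<nu>1"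
      using w w' by (auto simp: p_laplacian_def L2_\<nu>2)
    note [measurable] = L2_D(1)[OF L(1)] L2_D(1)[OF L(2)] L2_D(1)[OF L'(1)] L2_D(1)[OF L'(2)]
      L2_D(1)[OF wL(1)] L2_D(1)[OF wL(2)] L2_D(1)[OF wL(3)] L2_D(1)[OF wL(4)]
    show ?thesis
    proof (rule completely_accretive_criterion[OF L2_diff[OF L(1) L'(1)] L2_diff[OF L(2) L'(2)] t j])
      fix T :: "real \<Rightarrow> real"
      assume T: "mono T" and T_le: "\<And>s. 0 < s \<Longrightarrow> \<exists>K. \<forall>a. \<bar>T a\<bar> powr s \<le> K * a\<^sup>2"
      have [measurable]: "T \<in> borel_measurable borel" using T by (rule borel_measurable_mono)
      let ?\<phi> = "\<lambda>x. T (u x - u' x)"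
      \<comment> \<open>The exponents q and p admit T(u - u') in the two accretivity inequalities;
        exponent 2 lets it be paired with the square integrable Laplacians.\<close>
      obtain K1 where K1: "\<And>a. \<bar>T a\<bar> powr q \<le> K1 * a\<^sup>2" using T_le[of q] q by auto
      obtain K2 where K2: "\<And>a. \<bar>T a\<bar> powr p \<le> K2 * a\<^sup>2" using T_le[of p] p by auto
      obtain K where K: "\<And>a. \<bar>T a\<bar> powr 2 \<le> K * a\<^sup>2" using T_le[of 2] by auto
      have \<phi>: "?\<phi> \<in> L2 \<nu>1"
      proof (rule L2_dominated)
        show "integrable \<nu>1 (\<lambda>x. K * (u x - u' x)\<^sup>2)" using L2_diff[OF L(1) L'(1)] by (auto simp: L2_def)
        show "AE x in \<nu>1. (?\<phi> x)\<^sup>2 \<le> K * (u x - u' x)\<^sup>2" using K by simp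
      qed measurable
      have i1: "integrable \<nu>1 (\<lambda>x. (w1 x - w1' x) * ?\<phi> x)"
        and i2: "integrable \<nu>1 (\<lambda>x. \<mu> x * (w2 x - w2' x) * ?\<phi> x)"
        by (intro L2_mult_integrable L2_\<mu>_mult L2_diff wL \<phi>)+
      have "(\<integral>x. (w1 x - w1' x) * ?\<phi> x \<partial>\<nu>1) \<le> 0"
        by (rule W1.p_laplacian_T_accretive[OF q w(1) w'(1) T K1])
      moreover have "(\<integral>x. (w2 x - w2' x) * ?\<phi> x \<partial>\<nu>2) \<le> 0"
        by (rule W2.p_laplacian_T_accretive[OF p w(2) w'(2) T K2])
      moreover have "(\<integral>x. (w2 x - w2' x) * ?\<phi> x \<partial>\<nu>2) = (\<integral>x. \<mu> x * (w2 x - w2' x) * ?\<phi> x \<partial>\<nu>1)"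
        by (subst integral_\<nu>2) (auto simp: mult.assoc)
      moreover have "(\<integral>x. (v x - v' x) * ?\<phi> x \<partial>\<nu>1) =
          (\<integral>x. - ((w1 x - w1' x) * ?\<phi> x) - \<mu> x * (w2 x - w2' x) * ?\<phi> x \<partial>\<nu>1)"
      proof (rule integral_cong_AE)
        show "AE x in \<nu>1. (v x - v' x) * ?\<phi> x = - ((w1 x - w1' x) * ?\<phi> x) - \<mu> x * (w2 x - w2' x) * ?\<phi> x"
          using w(3) w'(3)
        proof eventually_elim
          case (elim x)
          show ?case unfolding elim by (simp add: algebra_simps)
        qed
      qed measurable
      ultimately show "0 \<le> (\<integral>x. (v x - v' x) * ?\<phi> x \<partial>\<nu>1)" using i1 i2 by simp
    qed
  qed
  then show ?thesis unfolding completely_accretive_def by blast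
qed

text \<open>One truncation of f serves both Laplacians, since it controls every exponent and the two
  L2 spaces coincide; convergence to f is dominated by (2f)^2.\<close>

lemma sum_operator_dense_domain:
  assumes q: "1 < q" and p: "1 < p"
  shows "dense_domain \<nu>1 (sum_operator m1 \<nu>1 q m2 \<nu>2 p \<mu>)"
  unfolding dense_domain_def
proof (intro ballI allI impI)
  fix f and \<epsilon> :: real assume f: "f \<in> L2 \<nu>1" and \<epsilon>: "0 < \<epsilon>"
  have [measurable]: "f \<in> borel_measurable \<nu>1" using f by (simp add: L2_def)
  have "(\<lambda>n. \<integral>x. (f x - trunc n (f x))\<^sup>2 \<partial>\<nu>1) \<longlonglongrightarrow> (\<integral>x. 0 \<partial>\<nu>1)"
  proof (rule integral_dominated_convergence)
    show "integrable \<nu>1 (\<lambda>x. (2 * f x)\<^sup>2)" using f by (simp add: L2_def power_mult_distrib)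
    have "(\<lambda>n. (f x - trunc n (f x))\<^sup>2) \<longlonglongrightarrow> (f x - f x)\<^sup>2" for x
      by (intro tendsto_intros trunc_tendsto)
    then show "AE x in \<nu>1. (\<lambda>n. (f x - trunc n (f x))\<^sup>2) \<longlonglongrightarrow> 0" by simp
    have "\<bar>a - trunc n a\<bar> \<le> \<bar>2 * a\<bar>" for n a using abs_trunc_le(1)[of n a] by linarith
    then show "AE x in \<nu>1. norm ((f x - trunc n (f x))\<^sup>2) \<le> (2 * f x)\<^sup>2" for n
      by (simp only: abs_le_square_iff real_norm_def abs_power2) simp
  qed measurable
  then have "\<forall>\<^sub>F n in sequentially. (\<integral>x. (f x - trunc n (f x))\<^sup>2 \<partial>\<nu>1) < \<epsilon>"
    using \<epsilon> by (intro order_tendstoD(2)) auto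
  then obtain n where n: "(\<integral>x. (f x - trunc n (f x))\<^sup>2 \<partial>\<nu>1) < \<epsilon>"
    by (auto simp: eventually_sequentially)
  let ?u = "\<lambda>x. trunc n (f x)"
  let ?v = "\<lambda>x. - W1.laplace q ?u x - \<mu> x * W2.laplace p ?u x"
  have l: "(?u, W1.laplace q ?u) \<in> p_laplacian m1 \<nu>1 q" "(?u, W2.laplace p ?u) \<in> p_laplacian m2 \<nu>2 p"
    using f by (auto simp: L2_\<nu>2 intro!: W1.p_laplacian_trunc W2.p_laplacian_trunc q p)
  then have L: "?u \<in> L2 \<nu>1" "W1.laplace q ?u \<in> L2 \<nu>1" "W2.laplace p ?u \<in> L2 \<nu>1"
    by (auto simp: p_laplacian_def L2_\<nu>2)
  have "(\<lambda>x. - 1 * W1.laplace q ?u x - \<mu> x * W2.laplace p ?u x) \<in> L2 \<nu>1"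
    by (intro L2_diff L2_cmult L2_\<mu>_mult L)
  then have "(?u, ?v) \<in> sum_operator m1 \<nu>1 q m2 \<nu>2 p \<mu>"
    using l L by (auto simp: sum_operator_def)
  with n show "\<exists>(u, v)\<in>sum_operator m1 \<nu>1 q m2 \<nu>2 p \<mu>. (\<integral>x. (f x - u x)\<^sup>2 \<partial>\<nu>1) < \<epsilon>"
    by (intro bexI[of _ "(?u, ?v)"]) auto
qed

end

theorem theorem3p9:
  fixes m1 m2 :: "'a \<Rightarrow> 'a measure" and \<nu>1 \<nu>2 :: "'a measure"
    and \<mu> :: "'a \<Rightarrow> real" and p q c :: real
  assumes q: "1 < q" "q \<le> 2" and p: "1 < p"
    and rws1: "random_walk_space m1 \<nu>1" "reversible m1 \<nu>1"
    and rws2: "random_walk_space m2 \<nu>2" "reversible m2 \<nu>2"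
    and same_space: "sets \<nu>2 = sets \<nu>1"
    and mu_meas: "\<mu> \<in> borel_measurable \<nu>1"
    and RN: "\<nu>2 = density \<nu>1 (\<lambda>x. ennreal (\<mu> x))"
    and mu_Linf: "\<exists>C. AE x in \<nu>1. \<bar>\<mu> x\<bar> \<le> C"
    and c: "c > 0" "AE x in \<nu>1. \<mu> x \<ge> c"
    and cases: "emeasure \<nu>1 (space \<nu>1) < \<infinity> \<or>
      (emeasure \<nu>1 (space \<nu>1) = \<infinity> \<and> q \<le> p / (p - 1) \<and> p / (p - 1) \<le> 2 \<and> 2 \<le> p)"
  shows "subdiff \<nu>1 (\<lambda>u. energy m1 \<nu>1 q u + energy m2 \<nu>2 p u) = sum_operator m1 \<nu>1 q m2 \<nu>2 p \<mu>
     \<and> completely_accretive \<nu>1 (sum_operator m1 \<nu>1 q m2 \<nu>2 p \<mu>)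
     \<and> dense_domain \<nu>1 (sum_operator m1 \<nu>1 q m2 \<nu>2 p \<mu>)"
proof -
  obtain C where C: "AE x in \<nu>1. \<bar>\<mu> x\<bar> \<le> C" using mu_Linf by blast
  interpret two_walks m1 m2 \<nu>1 \<nu>2 \<mu> c C
    by standard fact+
  have "subdiff \<nu>1 (total_energy q p) = sum_operator m1 \<nu>1 q m2 \<nu>2 p \<mu>"
    using subdiff_subset_sum_operator[OF q p] sum_operator_subset_subdiff[OF q(1) p] cases by blast
  then show ?thesis
    using sum_operator_completely_accretive[OF q(1) p] sum_operator_dense_domain[OF q(1) p]
    by (simp add: total_energy_def[abs_def])
qed

end
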